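(* Consider a $k$-Median instance with $2\le k\le n/3$ in which every customer $j\in W$ has a center $i\in U$ with $c_{ij}=0$. There is an algorithm that, given only the instance, computes in $O(k\,m\log(n/k)\log m)$ time a value $\lambda\in\mathbb{R}_{\ge0}\cup\{\infty\}$ with $\lambda\le\lambda^*$ and a set $C\subseteq U$ with $|C|\le T$ such that $\tilde c(\lambda,C)<1$.
   Context: A $k$-Median instance is a bipartite graph $G=(U,W,E)$ (centers $U$, customers $W$), costs $c_{ij}\ge0$ for $(i,j)\in E$, $c_{ij}=\infty$ for $(i,j)\notin E$, and a positive integer $k$; $n=|W|$, $m=|E|$. $T=\lceil k\ln(n^2/(2k(2k+1)))\rceil$. $\lambda^*\in\mathbb{R}_{\ge0}\cup\{\infty\}$ is the optimum value of the LP: minimize $\sum_{(i,j)\in E}c_{ij}y_{ij}$ subject to $x_i\ge y_{ij}\ge0$ for all $(i,j)\in E$, $\sum_{i:(i,j)\in E}y_{ij}=1$ for all $j\in W$, $\sum_{i\in U}x_i=k$ ($\lambda^*=\infty$ if infeasible). For $\lambda\in\mathbb{R}_{\ge0}\cup\{\infty\}$ and $C\subseteq U$, the capped cost of customer $j$ is $\tilde c_j(\lambda,C)=\min\big(1/(2k+1),\,(1-2k/n)\min_{i\in C}c_{ij}/\lambda\big)$, where $0/0$ and $\infty/\infty$ are interpreted as $0$ (and the minimum over the empty set is $\infty$), and the capped cost of $C$ is $\tilde c(\lambda,C)=\sum_{j\in W}\tilde c_j(\lambda,C)$.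
   Formalization: The LP is taken with the extra constraint x_i ≥ 0 for every center i; this matters only for centers without edges, which could otherwise take negative x_i, making λ* = 0 and the claim false (e.g. k=2, 100 customers with private zero-cost centers and one isolated center). *)

theory Defs
  imports "HOL-Analysis.Analysis"
begin

section \<open>k-Median instances\<close>

record ('u, 'v) kmedian =
  centers :: "'u set"
  customers :: "'v set"
  edges :: "('u \<times> 'v) set"
  cost :: "'u \<Rightarrow> 'v \<Rightarrow> real"
  medians :: nat  \<comment> \<open>the parameter k\<close>

definition kmedian_instance :: "('u, 'v) kmedian \<Rightarrow> bool" where
  "kmedian_instance G \<longleftrightarrow>
     finite (centers G) \<and> finite (customers G) \<and> edges G \<subseteq> centers G \<times> customers G \<and>
     (\<forall>(i, j) \<in> edges G. 0 \<le> cost G i j) \<and> 0 < medians G"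

definition ext_cost :: "('u, 'v) kmedian \<Rightarrow> 'u \<Rightarrow> 'v \<Rightarrow> ennreal" where
  "ext_cost G i j = (if (i, j) \<in> edges G then ennreal (cost G i j) else \<infinity>)"

definition num_customers :: "('u, 'v) kmedian \<Rightarrow> nat" where
  "num_customers G = card (customers G)"

definition num_edges :: "('u, 'v) kmedian \<Rightarrow> nat" where
  "num_edges G = card (edges G)"

definition center_bound :: "('u, 'v) kmedian \<Rightarrow> int" where
  "center_bound G = (let k = real (medians G); n = real (num_customers G)
     in \<lceil>k * ln (n\<^sup>2 / (2 * k * (2 * k + 1)))\<rceil>)"

text \<open>
  The constraint \<open>0 \<le> x i\<close> follows from the edge constraints unless the center \<open>i\<close> is isolated.
  It is explicit so that an isolated center cannot enlarge the budget of the others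
  through a negative \<open>x i\<close>.
\<close>

definition lp_feasible :: "('u, 'v) kmedian \<Rightarrow> ('u \<Rightarrow> real) \<Rightarrow> ('u \<Rightarrow> 'v \<Rightarrow> real) \<Rightarrow> bool" where
  "lp_feasible G x y \<longleftrightarrow>
     (\<forall>(i, j) \<in> edges G. 0 \<le> y i j \<and> y i j \<le> x i) \<and>
     (\<forall>i \<in> centers G. 0 \<le> x i) \<and>
     (\<forall>j \<in> customers G. (\<Sum>i | (i, j) \<in> edges G. y i j) = 1) \<and>
     (\<Sum>i \<in> centers G. x i) = real (medians G)"

text \<open>In \<^typ>\<open>ennreal\<close> the infimum of the empty set is \<open>\<infinity>\<close>, the value of an infeasible LP.\<close>

definition lp_opt :: "('u, 'v) kmedian \<Rightarrow> ennreal" where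
  "lp_opt G = Inf {ennreal (\<Sum>(i, j) \<in> edges G. cost G i j * y i j) | x y. lp_feasible G x y}"

text \<open>
  Division in \<^typ>\<open>ennreal\<close> satisfies \<open>0 / 0 = 0\<close>, \<open>\<infinity> / \<infinity> = 0\<close> and \<open>a / 0 = \<infinity>\<close> for \<open>a > 0\<close>.
  The quotient is taken of the minimum over \<open>C\<close>, which is \<open>\<infinity>\<close> for empty \<open>C\<close>.
\<close>

definition capped_cost_of :: "('u, 'v) kmedian \<Rightarrow> ennreal \<Rightarrow> 'u set \<Rightarrow> 'v \<Rightarrow> ennreal" where
  "capped_cost_of G lam C j = (let k = real (medians G); n = real (num_customers G)
     in min (ennreal (1 / (2 * k + 1)))
            (ennreal (1 - 2 * k / n) * ((INF i \<in> C. ext_cost G i j) / lam)))"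

definition capped_cost :: "('u, 'v) kmedian \<Rightarrow> ennreal \<Rightarrow> 'u set \<Rightarrow> ennreal" where
  "capped_cost G lam C = (\<Sum>j \<in> customers G. capped_cost_of G lam C j)"


section \<open>The machine model: real RAM programs\<close>

text \<open>
  A while language over the memory of a real RAM: finitely many named registers and arrays,
  holding either natural numbers (used for control and addressing) or exact real numbers.
  Natural numbers can be converted to reals but there is no conversion back (no floor function),
  there are no real constants except those obtained from natural numbers, and no multiplication
  of natural numbers.  Real division by \<open>0\<close> yields \<open>0\<close>.
\<close>

record store =
  nreg :: "string \<Rightarrow> nat"
  rreg :: "string \<Rightarrow> real"
  narr :: "string \<Rightarrow> nat \<Rightarrow> nat"
  rarr :: "string \<Rightarrow> nat \<Rightarrow> real"

datatype nexp =
    NConst nat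
  | NReg string
  | NArr string nexp
  | NAdd nexp nexp
  | NSub nexp nexp
  | NHalf nexp

datatype rexp =
    RNat nexp
  | RReg string
  | RArr string nexp
  | RAdd rexp rexp
  | RSub rexp rexp
  | RMul rexp rexp
  | RDiv rexp rexp

datatype test =
    NLess nexp nexp
  | RLess rexp rexp
  | TNot test
  | TAnd test test

datatype com =
    Skip
  | NSet string nexp
  | RSet string rexp
  | NStore string nexp nexp
  | RStore string nexp rexp
  | Seq com com
  | Cond test com com
  | While test com

primrec neval :: "nexp \<Rightarrow> store \<Rightarrow> nat" where
  "neval (NConst c) s = c"
| "neval (NReg x) s = nreg s x"
| "neval (NArr a e) s = narr s a (neval e s)"
| "neval (NAdd e f) s = neval e s + neval f s"
| "neval (NSub e f) s = neval e s - neval f s"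
| "neval (NHalf e) s = neval e s div 2"

primrec reval :: "rexp \<Rightarrow> store \<Rightarrow> real" where
  "reval (RNat e) s = real (neval e s)"
| "reval (RReg x) s = rreg s x"
| "reval (RArr a e) s = rarr s a (neval e s)"
| "reval (RAdd e f) s = reval e s + reval f s"
| "reval (RSub e f) s = reval e s - reval f s"
| "reval (RMul e f) s = reval e s * reval f s"
| "reval (RDiv e f) s = reval e s / reval f s"

primrec teval :: "test \<Rightarrow> store \<Rightarrow> bool" where
  "teval (NLess e f) s \<longleftrightarrow> neval e s < neval f s"
| "teval (RLess e f) s \<longleftrightarrow> reval e s < reval f s"
| "teval (TNot b) s \<longleftrightarrow> \<not> teval b s"
| "teval (TAnd b c) s \<longleftrightarrow> teval b s \<and> teval c s"

text \<open>
  \<open>exec P s t s'\<close>: started in \<open>s\<close>, the program \<open>P\<close> halts in \<open>s'\<close> after \<open>t\<close> steps.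
  Each executed assignment and each evaluated test is one step; as the expressions are part of
  the program, this agrees up to a constant factor depending only on \<open>P\<close> with charging one
  unit per arithmetic operation, comparison and memory access.
\<close>

inductive exec :: "com \<Rightarrow> store \<Rightarrow> nat \<Rightarrow> store \<Rightarrow> bool" where
  Skip: "exec Skip s 1 s"
| NSet: "exec (NSet x e) s 1 (s\<lparr>nreg := (nreg s)(x := neval e s)\<rparr>)"
| RSet: "exec (RSet x e) s 1 (s\<lparr>rreg := (rreg s)(x := reval e s)\<rparr>)"
| NStore: "exec (NStore a e f) s 1
    (s\<lparr>narr := (narr s)(a := (narr s a)(neval e s := neval f s))\<rparr>)"
| RStore: "exec (RStore a e f) s 1
    (s\<lparr>rarr := (rarr s)(a := (rarr s a)(neval e s := reval f s))\<rparr>)"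
| Seq: "exec P s t s' \<Longrightarrow> exec Q s' t' s'' \<Longrightarrow> exec (Seq P Q) s (t + t') s''"
| CondTrue: "teval b s \<Longrightarrow> exec P s t s' \<Longrightarrow> exec (Cond b P Q) s (Suc t) s'"
| CondFalse: "\<not> teval b s \<Longrightarrow> exec Q s t s' \<Longrightarrow> exec (Cond b P Q) s (Suc t) s'"
| WhileFalse: "\<not> teval b s \<Longrightarrow> exec (While b P) s 1 s"
| WhileTrue: "teval b s \<Longrightarrow> exec P s t s' \<Longrightarrow> exec (While b P) s' t' s'' \<Longrightarrow>
    exec (While b P) s (Suc (t + t')) s''"

inductive_cases exec_elims:
  "exec Skip s t s'" "exec (NSet x e) s t s'" "exec (RSet x e) s t s'"
  "exec (NStore a e f) s t s'" "exec (RStore a e f) s t s'" "exec (Seq P Q) s t s'"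
  "exec (Cond b P Q) s t s'" "exec (While b P) s t s'"

lemma exec_deterministic:
  assumes "exec P s t s'" and "exec P s u s''"
  shows "u = t \<and> s'' = s'"
  using assms
proof (induction arbitrary: u s'' rule: exec.induct)
  case (Seq P s t s' Q t' s2)
  from Seq.prems Seq.IH show ?case by (blast elim: exec_elims)
next
  case (CondTrue b s P t s' Q)
  from CondTrue.prems CondTrue.IH CondTrue.hyps show ?case by (blast elim: exec_elims)
next
  case (CondFalse b s Q t s' P)
  from CondFalse.prems CondFalse.IH CondFalse.hyps show ?case by (blast elim: exec_elims)
next
  case (WhileTrue b s P t s' t' s2)
  from WhileTrue.prems WhileTrue.IH WhileTrue.hyps show ?case by (blast elim: exec_elims)
qed (auto elim: exec_elims)


section \<open>Input and output conventions\<close>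

text \<open>
  The centers and the customers are numbered from \<open>0\<close>, and the graph is given as a list of its
  edges, in arbitrary order, each with its cost.  The rest of the memory is initially \<open>0\<close>.
\<close>

definition edge_list :: "(nat, nat) kmedian \<Rightarrow> (nat \<times> nat) list \<Rightarrow> bool" where
  "edge_list G es \<longleftrightarrow>
     centers G = {..<card (centers G)} \<and> customers G = {..<card (customers G)} \<and>
     distinct es \<and> set es = edges G"

definition input_store :: "(nat, nat) kmedian \<Rightarrow> (nat \<times> nat) list \<Rightarrow> store" where
  "input_store G es =
     \<lparr>nreg = (\<lambda>_. 0)(''k'' := medians G, ''u'' := card (centers G),
                     ''n'' := card (customers G), ''m'' := length es),
      rreg = (\<lambda>_. 0),
      narr = (\<lambda>_ _. 0)(''center'' := (\<lambda>e. if e < length es then fst (es ! e) else 0),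
                       ''customer'' := (\<lambda>e. if e < length es then snd (es ! e) else 0)),
      rarr = (\<lambda>_ _. 0)(''cost'' := (\<lambda>e. if e < length es
                                          then cost G (fst (es ! e)) (snd (es ! e)) else 0))\<rparr>"

text \<open>The value \<open>lam = \<infinity>\<close> is signalled by a nonzero flag.\<close>

definition outputs :: "store \<Rightarrow> ennreal \<Rightarrow> nat set \<Rightarrow> bool" where
  "outputs s lam C \<longleftrightarrow>
     (if nreg s ''infinite'' \<noteq> 0 then lam = \<infinity>
      else 0 \<le> rreg s ''lambda'' \<and> lam = ennreal (rreg s ''lambda'')) \<and>
     C = narr s ''C'' ` {..<nreg s ''size''}"

end

theory Submission
  imports Defs
begin

text \<open>
  Write \<open>mu = 1 / lambda\<close>, so that \<open>mu = 0\<close> stands for \<open>lambda = \<infinity>\<close>. For fixed \<open>mu\<close>, run a greedy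
  algorithm on the capped cost. Drawing a center with probability proportional to \<open>x\<close> from a
  fractional solution of value at most \<open>1 / mu\<close> moves the capped cost a fraction \<open>1 / k\<close> of the way
  to \<open>1 - 2k/n\<close> in expectation. So either some center achieves this decrease, or no such solution
  exists and \<open>1 / mu\<close> is a lower bound on the LP optimum. If the decrease is always achieved,
  then \<open>T\<close> rounds lead strictly below \<open>1\<close>, in fact below a rational threshold at distance at least
  \<open>6/n\<^sup>2\<close> from \<open>1\<close>; stopping at the threshold spares the machine the logarithm in \<open>T\<close>.

  It remains to find a failing \<open>lambda\<close> for which the centers of a succeeding one still work.
  Binary search over the sorted edge costs yields a failing value \<open>L\<close> (or \<open>L = 0\<close>) and a succeeding
  value \<open>H\<close> (or \<open>H = \<infinity>\<close>) with no edge cost strictly in between. Costs at least \<open>H\<close> are capped at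
  \<open>H\<close>, so the centers found for \<open>H\<close> only use costs at most \<open>L\<close>. If \<open>L n\<^sup>3\<close> fails as well, these costs are
  negligible at \<open>L n\<^sup>3\<close>. Otherwise \<open>O(log n)\<close> bisection steps on \<open>[L, L n\<^sup>3]\<close> bring the ratio of the
  two values below \<open>1 + 1/n\<^sup>2\<close>, which the slack of the threshold absorbs.
\<close>

section \<open>Timed execution\<close>

abbreviation Seq_syntax :: "com \<Rightarrow> com \<Rightarrow> com" (infixr ";;" 60) where
  "P ;; Q \<equiv> Seq P Q"

text \<open>Total correctness with a time budget. Bounding the steps from above, rather than
  counting them exactly, lets the costs of branches and loops be rounded up.\<close>

definition runs :: "com \<Rightarrow> store \<Rightarrow> nat \<Rightarrow> (store \<Rightarrow> bool) \<Rightarrow> bool" where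
  "runs P s N Q \<longleftrightarrow> (\<exists>t s'. exec P s t s' \<and> t \<le> N \<and> Q s')"

lemma exec_atomic:
  "exec Skip s t s' \<longleftrightarrow> t = 1 \<and> s' = s"
  "exec (NSet x e) s t s' \<longleftrightarrow> t = 1 \<and> s' = s\<lparr>nreg := (nreg s)(x := neval e s)\<rparr>"
  "exec (RSet x f) s t s' \<longleftrightarrow> t = 1 \<and> s' = s\<lparr>rreg := (rreg s)(x := reval f s)\<rparr>"
  "exec (NStore a e e') s t s' \<longleftrightarrow>
     t = 1 \<and> s' = s\<lparr>narr := (narr s)(a := (narr s a)(neval e s := neval e' s))\<rparr>"
  "exec (RStore a e f) s t s' \<longleftrightarrow>
     t = 1 \<and> s' = s\<lparr>rarr := (rarr s)(a := (rarr s a)(neval e s := reval f s))\<rparr>"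
  by (auto elim: exec_elims intro: exec.intros(1-5)[unfolded One_nat_def])

lemma runs_Skip [simp]: "runs Skip s N Q \<longleftrightarrow> 1 \<le> N \<and> Q s"
  by (simp add: runs_def exec_atomic)

lemma runs_NSet [simp]:
  "runs (NSet x e) s N Q \<longleftrightarrow> 1 \<le> N \<and> Q (s\<lparr>nreg := (nreg s)(x := neval e s)\<rparr>)"
  by (simp add: runs_def exec_atomic)

lemma runs_RSet [simp]:
  "runs (RSet x e) s N Q \<longleftrightarrow> 1 \<le> N \<and> Q (s\<lparr>rreg := (rreg s)(x := reval e s)\<rparr>)"
  by (simp add: runs_def exec_atomic)

lemma runs_NStore [simp]:
  "runs (NStore a e f) s N Q \<longleftrightarrow>
     1 \<le> N \<and> Q (s\<lparr>narr := (narr s)(a := (narr s a)(neval e s := neval f s))\<rparr>)"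
  by (simp add: runs_def exec_atomic)

lemma runs_RStore [simp]:
  "runs (RStore a e f) s N Q \<longleftrightarrow>
     1 \<le> N \<and> Q (s\<lparr>rarr := (rarr s)(a := (rarr s a)(neval e s := reval f s))\<rparr>)"
  by (simp add: runs_def exec_atomic)

lemma runs_Seq:
  "runs P s a (\<lambda>s'. runs Q s' b R) \<Longrightarrow> a + b \<le> N \<Longrightarrow> runs (P ;; Q) s N R"
  unfolding runs_def by (meson add_mono exec.Seq order_trans)

lemma exec_Seq:
  "exec (P ;; Q) s t s' \<longleftrightarrow> (\<exists>t1 u t2. exec P s t1 u \<and> exec Q u t2 s' \<and> t = t1 + t2)"
proof
  assume "exec (P ;; Q) s t s'"
  then show "\<exists>t1 u t2. exec P s t1 u \<and> exec Q u t2 s' \<and> t = t1 + t2"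
    by (rule exec_elims) blast
qed (auto intro: exec.Seq)

text \<open>As an equivalence this serves the simplifier: straight-line code is executed
  symbolically, each assignment consuming one unit of the budget.\<close>

lemma runs_Seq_atomic:
  assumes "\<And>t s'. exec P s t s' \<longleftrightarrow> t = 1 \<and> s' = u"
  shows "runs (P ;; Q) s N R \<longleftrightarrow> 1 \<le> N \<and> runs Q u (N - 1) R"
proof
  assume "runs (P ;; Q) s N R"
  then obtain t s' where t: "exec (P ;; Q) s t s'" "t \<le> N" "R s'" by (auto simp: runs_def)
  from t(1) obtain t1 u' t2 where "exec P s t1 u'" "exec Q u' t2 s'" "t = t1 + t2"
    by (auto elim: exec_elims)
  with t assms show "1 \<le> N \<and> runs Q u (N - 1) R"
    unfolding runs_def by (auto intro!: exI[of _ t2] exI[of _ s'])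
next
  assume "1 \<le> N \<and> runs Q u (N - 1) R"
  then show "runs (P ;; Q) s N R"
    using assms by (intro runs_Seq[of P s 1 Q "N - 1"]) (auto simp: runs_def)
qed

lemma runs_Seq_NSet [simp]:
  "runs (NSet x e ;; Q) s N R \<longleftrightarrow>
     1 \<le> N \<and> runs Q (s\<lparr>nreg := (nreg s)(x := neval e s)\<rparr>) (N - 1) R"
  by (rule runs_Seq_atomic) (rule exec_atomic)

lemma runs_Seq_RSet [simp]:
  "runs (RSet x e ;; Q) s N R \<longleftrightarrow>
     1 \<le> N \<and> runs Q (s\<lparr>rreg := (rreg s)(x := reval e s)\<rparr>) (N - 1) R"
  by (rule runs_Seq_atomic) (rule exec_atomic)

lemma runs_Seq_NStore [simp]:
  "runs (NStore a e f ;; Q) s N R \<longleftrightarrow>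
     1 \<le> N \<and> runs Q (s\<lparr>narr := (narr s)(a := (narr s a)(neval e s := neval f s))\<rparr>) (N - 1) R"
  by (rule runs_Seq_atomic) (rule exec_atomic)

lemma runs_Seq_RStore [simp]:
  "runs (RStore a e f ;; Q) s N R \<longleftrightarrow>
     1 \<le> N \<and> runs Q (s\<lparr>rarr := (rarr s)(a := (rarr s a)(neval e s := reval f s))\<rparr>) (N - 1) R"
  by (rule runs_Seq_atomic) (rule exec_atomic)

lemma runs_Seq_Skip [simp]: "runs (Skip ;; Q) s N R \<longleftrightarrow> 1 \<le> N \<and> runs Q s (N - 1) R"
  by (rule runs_Seq_atomic) (rule exec_atomic)

text \<open>Right-nesting keeps the next atomic command at the head, where the rewrite rules
  apply.\<close>

lemma runs_Seq_assoc [simp]: "runs ((P ;; Q) ;; R) s N S \<longleftrightarrow> runs (P ;; Q ;; R) s N S"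
proof -
  have "exec ((P ;; Q) ;; R) s t s' \<longleftrightarrow> exec (P ;; Q ;; R) s t s'" for t s'
    unfolding exec_Seq by (metis add.assoc)
  then show ?thesis by (simp add: runs_def)
qed

lemma exec_Cond:
  "exec (Cond b P Q) s t s' \<longleftrightarrow> (\<exists>t'. t = Suc t' \<and> exec (if teval b s then P else Q) s t' s')"
  by (cases "teval b s") (auto elim: exec_elims intro: exec.CondTrue exec.CondFalse)

lemma runs_Cond [simp]:
  "runs (Cond b P Q) s N R \<longleftrightarrow>
     1 \<le> N \<and> (teval b s \<longrightarrow> runs P s (N - 1) R) \<and> (\<not> teval b s \<longrightarrow> runs Q s (N - 1) R)"
  unfolding runs_def exec_Cond
  by (cases N) (auto simp: Suc_le_eq less_Suc_eq_le)

lemma exec_Seq_Cond: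
  "exec (Cond b P P' ;; Q) s t s' \<longleftrightarrow>
     (\<exists>t'. t = Suc t' \<and> exec ((if teval b s then P else P') ;; Q) s t' s')"
  unfolding exec_Seq exec_Cond by (metis add_Suc)

lemma runs_Seq_Cond [simp]:
  "runs (Cond b P P' ;; Q) s N R \<longleftrightarrow>
     1 \<le> N \<and> (teval b s \<longrightarrow> runs (P ;; Q) s (N - 1) R) \<and> (\<not> teval b s \<longrightarrow> runs (P' ;; Q) s (N - 1) R)"
  unfolding runs_def exec_Seq_Cond
  by (cases N) (auto simp: Suc_le_eq less_Suc_eq_le)

lemma runs_mono: "runs P s N Q \<Longrightarrow> N \<le> N' \<Longrightarrow> (\<And>s'. Q s' \<Longrightarrow> Q' s') \<Longrightarrow> runs P s N' Q'"
  unfolding runs_def by (meson order_trans)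

section \<open>Frame conditions\<close>

primrec nregs :: "com \<Rightarrow> string set" where
  "nregs Skip = {}"
| "nregs (NSet x e) = {x}"
| "nregs (RSet x e) = {}"
| "nregs (NStore a e f) = {}"
| "nregs (RStore a e f) = {}"
| "nregs (P ;; Q) = nregs P \<union> nregs Q"
| "nregs (Cond b P Q) = nregs P \<union> nregs Q"
| "nregs (While b P) = nregs P"

primrec rregs :: "com \<Rightarrow> string set" where
  "rregs Skip = {}"
| "rregs (NSet x e) = {}"
| "rregs (RSet x e) = {x}"
| "rregs (NStore a e f) = {}"
| "rregs (RStore a e f) = {}"
| "rregs (P ;; Q) = rregs P \<union> rregs Q"
| "rregs (Cond b P Q) = rregs P \<union> rregs Q"
| "rregs (While b P) = rregs P"

primrec narrs :: "com \<Rightarrow> string set" where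
  "narrs Skip = {}"
| "narrs (NSet x e) = {}"
| "narrs (RSet x e) = {}"
| "narrs (NStore a e f) = {a}"
| "narrs (RStore a e f) = {}"
| "narrs (P ;; Q) = narrs P \<union> narrs Q"
| "narrs (Cond b P Q) = narrs P \<union> narrs Q"
| "narrs (While b P) = narrs P"

primrec rarrs :: "com \<Rightarrow> string set" where
  "rarrs Skip = {}"
| "rarrs (NSet x e) = {}"
| "rarrs (RSet x e) = {}"
| "rarrs (NStore a e f) = {}"
| "rarrs (RStore a e f) = {a}"
| "rarrs (P ;; Q) = rarrs P \<union> rarrs Q"
| "rarrs (Cond b P Q) = rarrs P \<union> rarrs Q"
| "rarrs (While b P) = rarrs P"

text \<open>A syntactic over-approximation of what \<open>P\<close> may modify. With it, loop
  invariants need to mention only memory that the loop writes.\<close>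

definition unchanged :: "com \<Rightarrow> store \<Rightarrow> store \<Rightarrow> bool" where
  "unchanged P s s' \<longleftrightarrow>
     (\<forall>x. x \<notin> nregs P \<longrightarrow> nreg s' x = nreg s x) \<and> (\<forall>x. x \<notin> rregs P \<longrightarrow> rreg s' x = rreg s x) \<and>
     (\<forall>a. a \<notin> narrs P \<longrightarrow> narr s' a = narr s a) \<and> (\<forall>a. a \<notin> rarrs P \<longrightarrow> rarr s' a = rarr s a)"

lemma unchanged_refl: "unchanged P s s"
  by (simp add: unchanged_def)

lemma unchanged_trans: "unchanged P s s' \<Longrightarrow> unchanged P s' s'' \<Longrightarrow> unchanged P s s''"
  by (simp add: unchanged_def)

lemma exec_unchanged: "exec P s t s' \<Longrightarrow> unchanged P s s'"
  by (induction rule: exec.induct) (auto simp: unchanged_def)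

lemma runs_unchanged: "runs P s N Q \<Longrightarrow> runs P s N (\<lambda>s'. Q s' \<and> unchanged P s s')"
  unfolding runs_def using exec_unchanged by blast

section \<open>Loop rules\<close>

lemma runs_While_False: "\<not> teval b s \<Longrightarrow> 1 \<le> N \<Longrightarrow> Q s \<Longrightarrow> runs (While b P) s N Q"
  unfolding runs_def by (meson exec.WhileFalse)

text \<open>The index of \<open>I\<close> bounds the remaining iterations, which yields termination
  and time at once: the body may run only at a positive index and must lower it. Each round costs
  \<open>Suc B\<close> because of its test, and the last \<open>1\<close> is the failing
  test.\<close>

lemma runs_While:
  assumes "I i s"
    and body: "\<And>i s'. I i s' \<Longrightarrow> unchanged P s s' \<Longrightarrow> teval b s' \<Longrightarrow> 0 < i \<and> runs P s' B (I (i - 1))"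
    and exit: "\<And>i s'. I i s' \<Longrightarrow> unchanged P s s' \<Longrightarrow> \<not> teval b s' \<Longrightarrow> Q s'"
    and "i * Suc B + 1 \<le> N"
  shows "runs (While b P) s N Q"
proof -
  have "runs (While b P) s' (i * Suc B + 1) Q" if "I i s'" "unchanged P s s'" for i s'
    using that
  proof (induction i arbitrary: s')
    case 0
    then have "\<not> teval b s'" using body[of 0 s'] by blast
    with 0 exit[of 0 s'] show ?case by (simp add: runs_While_False)
  next
    case (Suc i)
    show ?case
    proof (cases "teval b s'")
      case False
      with Suc.prems exit[of "Suc i" s'] show ?thesis
        by (simp add: runs_While_False)
    next
      case True
      from runs_unchanged[of P s' B "I i"] body[OF Suc.prems True]
      obtain t u where u: "exec P s' t u" "t \<le> B" "I i u" "unchanged P s' u"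
        by (auto simp: runs_def)
      from Suc.IH[OF u(3) unchanged_trans[OF Suc.prems(2) u(4)]]
      obtain t' u' where "exec (While b P) u t' u'" "t' \<le> i * Suc B + 1" "Q u'"
        by (auto simp: runs_def)
      with u True show ?thesis unfolding runs_def
        by (intro exI[of _ "Suc (t + t')"] exI[of _ u']) (auto intro: exec.WhileTrue)
    qed
  qed
  from this[OF assms(1) unchanged_refl] assms(4) show ?thesis
    by (blast intro: runs_mono)
qed

definition For :: "string \<Rightarrow> string \<Rightarrow> com \<Rightarrow> com" where
  "For x y P = NSet x (NConst 0) ;;
     While (NLess (NReg x) (NReg y)) (P ;; NSet x (NAdd (NReg x) (NConst 1)))"

lemma For_vars [simp]:
  "nregs (For x y P) = insert x (nregs P)" "rregs (For x y P) = rregs P"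
  "narrs (For x y P) = narrs P" "rarrs (For x y P) = rarrs P"
  by (auto simp: For_def)

text \<open>\<open>J i\<close> speaks about the store in which the counter already is
  \<open>i\<close>, hence the update in the premise on the body. Beyond the body a round pays for
  the increment and the test; the final \<open>2\<close> pays for the initialization and the last
  test.\<close>

lemma runs_For:
  assumes start: "J 0 (s\<lparr>nreg := (nreg s)(x := 0)\<rparr>)"
    and M: "nreg s y = M" and vars: "x \<notin> nregs P" "y \<notin> nregs P" "x \<noteq> y"
    and body: "\<And>i s'. i < M \<Longrightarrow> J i s' \<Longrightarrow> nreg s' x = i \<Longrightarrow> unchanged (For x y P) s s' \<Longrightarrow>
      runs P s' B (\<lambda>s''. J (Suc i) (s''\<lparr>nreg := (nreg s'')(x := Suc i)\<rparr>))"
    and exit: "\<And>s'. J M s' \<Longrightarrow> unchanged (For x y P) s s' \<Longrightarrow> Q s'"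
    and N: "M * (B + 2) + 2 \<le> N"
  shows "runs (For x y P) s N Q"
proof -
  let ?s = "s\<lparr>nreg := (nreg s)(x := 0)\<rparr>"
  let ?P = "P ;; NSet x (NAdd (NReg x) (NConst 1))"
  have trans: "unchanged (For x y P) s s'" if "unchanged ?P ?s s'" for s'
    using that by (auto simp: unchanged_def)
  have "runs (While (NLess (NReg x) (NReg y)) ?P) ?s (N - 1) Q"
  \<comment> \<open>\<open>runs_While\<close> counts the rounds left while \<open>J\<close> counts
    the rounds done, hence \<open>M - i\<close>.\<close>
  proof (rule runs_While[where B = "B + 1" and i = M and
        I = "\<lambda>i s'. i \<le> M \<and> nreg s' x = M - i \<and> J (M - i) s'"])
    fix i s'
    assume I: "i \<le> M \<and> nreg s' x = M - i \<and> J (M - i) s'" and un: "unchanged ?P ?s s'"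
    from un vars M have y: "nreg s' y = M" by (auto simp: unchanged_def)
    {
      assume "teval (NLess (NReg x) (NReg y)) s'"
      with I y have i: "0 < i" "M - i < M" "Suc (M - i) = M - (i - 1)" by auto
      have "runs P s' B (\<lambda>s''. J (Suc (M - i)) (s''\<lparr>nreg := (nreg s'')(x := Suc (M - i))\<rparr>))"
        using I i body[of "M - i" s'] trans[OF un] by blast
      from runs_unchanged[OF this]
      have "runs P s' B (\<lambda>s''. runs (NSet x (NAdd (NReg x) (NConst 1))) s'' 1
            (\<lambda>s'. i - 1 \<le> M \<and> nreg s' x = M - (i - 1) \<and> J (M - (i - 1)) s'))"
        by (rule runs_mono) (use vars I i in \<open>auto simp: unchanged_def\<close>)
      then have "runs ?P s' (B + 1) (\<lambda>s'. i - 1 \<le> M \<and> nreg s' x = M - (i - 1) \<and> J (M - (i - 1)) s')"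
        by (rule runs_Seq) simp
      with i show "0 < i \<and> runs ?P s' (B + 1)
          (\<lambda>s'. i - 1 \<le> M \<and> nreg s' x = M - (i - 1) \<and> J (M - (i - 1)) s')" by blast
    }
    {
      assume "\<not> teval (NLess (NReg x) (NReg y)) s'"
      with I y have "i = 0" by auto
      with I show "Q s'" using exit trans[OF un] by simp
    }
  qed (use start N vars in auto)
  with N show ?thesis by (simp add: For_def)
qed

section \<open>Greedy decrease and LP lower bounds\<close>

lemma sum_nth_eq_sum_set:
  assumes "distinct xs"
  shows "(\<Sum>e<length xs. f (xs ! e)) = (\<Sum>p\<in>set xs. f p)"
  by (rule sum.reindex_bij_betw) (use assms bij_betw_nth in blast)

locale greedy_instance =
  fixes G :: "(nat, nat) kmedian" and es :: "(nat \<times> nat) list"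
  assumes inst: "kmedian_instance G"
    and listed: "edge_list G es"
    and k_ge_2: "2 \<le> medians G"
    and n_ge_3k: "3 * medians G \<le> card (customers G)"
    and zero_cost: "\<forall>j \<in> customers G. \<exists>i \<in> centers G. ext_cost G i j = 0"
begin

abbreviation "k \<equiv> medians G"
abbreviation "m \<equiv> length es"
abbreviation "cen e \<equiv> fst (es ! e)"
abbreviation "cus e \<equiv> snd (es ! e)"
abbreviation "cst e \<equiv> cost G (fst (es ! e)) (snd (es ! e))"

definition n :: nat where "n = card (customers G)"
definition al :: real where "al = 1 - 2 * real k / real n"
definition cap :: real where "cap = 1 / (2 * real k + 1)"
\<comment> \<open>\<open>al + q (n cap - al)\<close>, where \<open>q = 2k(2k+1)/n\<^sup>2\<close> bounds \<open>(1 - 1/k) ^ T\<close> and \<open>n cap\<close> is the capped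
  cost of the empty set\<close>
definition th :: real where "th = 1 - 2 * real k * (2 * real k + 1) / (real n)\<^sup>2 * al"
definition T :: nat where "T = nat (center_bound G)"

lemma customers_eq: "customers G = {..<n}"
  using listed by (simp add: edge_list_def n_def)

lemma set_es: "set es = edges G" and distinct_es: "distinct es"
  using listed by (auto simp: edge_list_def)

lemma edges_sub: "edges G \<subseteq> centers G \<times> customers G"
  using inst by (simp add: kmedian_instance_def)

lemma finite_centers: "finite (centers G)"
  using inst by (simp add: kmedian_instance_def)

lemma finite_edges: "finite (edges G)"
  using set_es finite_set by metis

lemma cost_nonneg: "(i, j) \<in> edges G \<Longrightarrow> 0 \<le> cost G i j"
  using inst by (auto simp: kmedian_instance_def)

lemma edge_in: "e < m \<Longrightarrow> (cen e, cus e) \<in> edges G"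
  using nth_mem[of e es] set_es by simp

lemma cen_in: "e < m \<Longrightarrow> cen e \<in> centers G"
  and cus_less: "e < m \<Longrightarrow> cus e < n"
  using edge_in[of e] edges_sub customers_eq by auto

lemma cst_nonneg: "e < m \<Longrightarrow> 0 \<le> cst e"
  using edge_in cost_nonneg by blast

lemma edge_index: "(i, j) \<in> edges G \<Longrightarrow> \<exists>e<m. cen e = i \<and> cus e = j"
  unfolding set_es[symmetric] in_set_conv_nth by force

lemma m_eq: "m = num_edges G"
  using set_es distinct_es distinct_card by (metis num_edges_def)

lemma n_le_m: "n \<le> m"
proof -
  have "customers G \<subseteq> snd ` set es"
    using zero_cost by (force simp: ext_cost_def set_es split: if_splits)
  then have "card (customers G) \<le> card (snd ` set es)"
    by (intro card_mono) auto
  then have "n \<le> card (snd ` set es)" by (simp add: n_def)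
  also have "\<dots> \<le> m"
    using card_image_le[OF finite_set, of snd es] card_length[of es] by linarith
  finally show ?thesis .
qed

lemma n_ge: "3 * k \<le> n"
  using n_ge_3k by (simp add: n_def)

lemma n_ge_6: "6 \<le> n"
  using k_ge_2 n_ge by linarith

section \<open>Constants: the threshold and the number of rounds\<close>

lemma al_bounds: "1 / 3 \<le> al" "al < 1"
  using k_ge_2 n_ge by (auto simp: al_def field_simps)

lemma cap_bounds: "0 < cap" "cap < 1 / 3"
  using k_ge_2 by (auto simp: cap_def field_simps)

text \<open>With \<open>k >= 2\<close> and \<open>al >= 1/3\<close>, the numerator
  \<open>2k(2k+1) al\<close> is at least \<open>20/3\<close>. This is the room in which centers
  found for one lambda are transferred to another.\<close>

lemma slack: "6 / (real n)\<^sup>2 \<le> 1 - th"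
proof -
  have k: "2 \<le> real k" using k_ge_2 by simp
  have "4 * 5 \<le> 2 * real k * (2 * real k + 1)"
    using k by (intro mult_mono) auto
  then have "20 * (1 / 3) \<le> 2 * real k * (2 * real k + 1) * al"
    using al_bounds by (intro mult_mono) auto
  then have "6 / (real n)\<^sup>2 \<le> (2 * real k * (2 * real k + 1) * al) / (real n)\<^sup>2"
    by (intro divide_right_mono) auto
  then show ?thesis by (simp add: th_def)
qed

text \<open>For \<open>q = 2k(2k+1)/n^2\<close> the product \<open>q * n * cap\<close> equals
  \<open>2k/n\<close>, which is \<open>1 - al\<close>. So the rational threshold is what the decay
  bound for \<open>T\<close> rounds gives.\<close>

lemma th_eq: "th = al + 2 * real k * (2 * real k + 1) / (real n)\<^sup>2 * (real n * cap - al)"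
proof -
  let ?q = "2 * real k * (2 * real k + 1) / (real n)\<^sup>2"
  have "?q * (real n * cap) = 2 * real k / real n"
    using n_ge_6 by (simp add: cap_def power2_eq_square)
  then have "al + ?q * (real n * cap - al) = al + 2 * real k / real n - ?q * al"
    by (simp only: right_diff_distrib)
  then show ?thesis by (simp add: th_def al_def)
qed

lemma n_cap: "1 \<le> real n * cap"
  using n_ge k_ge_2 by (simp add: cap_def field_simps)

lemma al_less_th: "al < th"
proof -
  have "0 < 2 * real k * (2 * real k + 1) / (real n)\<^sup>2"
    using k_ge_2 n_ge_6 by auto
  moreover have "0 < real n * cap - al" using n_cap al_bounds by linarith
  ultimately have "0 < 2 * real k * (2 * real k + 1) / (real n)\<^sup>2 * (real n * cap - al)"
    by (rule mult_pos_pos)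
  then show ?thesis unfolding th_eq by linarith
qed

lemma center_bound_eq:
  "center_bound G = \<lceil>real k * ln ((real n)\<^sup>2 / (2 * real k * (2 * real k + 1)))\<rceil>"
  by (simp add: center_bound_def num_customers_def n_def[symmetric] Let_def)

lemma ratio_gt_1: "1 < (real n)\<^sup>2 / (2 * real k * (2 * real k + 1))"
proof -
  have "2 * real k * (2 * real k + 1) < 9 * real k * real k"
    using k_ge_2 by (simp add: algebra_simps)
  also have "\<dots> = (3 * real k) * (3 * real k)" by simp
  also have "\<dots> \<le> real n * real n" using n_ge by (intro mult_mono) auto
  finally show ?thesis using k_ge_2 by (simp add: power2_eq_square)
qed

text \<open>The logarithm is positive by \<open>ratio_gt_1\<close>, so \<open>nat\<close> truncates
  nothing.\<close>

lemma T_eq: "int T = center_bound G"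
proof -
  have "0 \<le> center_bound G"
    unfolding center_bound_eq using ratio_gt_1
    by (smt (verit) ceiling_less_zero ln_gt_zero mult_nonneg_nonneg of_nat_0_le_iff)
  then show ?thesis by (simp add: T_def)
qed

lemma T_ge: "real k * ln ((real n)\<^sup>2 / (2 * real k * (2 * real k + 1))) \<le> real T"
  using T_eq center_bound_eq by (metis le_of_int_ceiling of_int_of_nat_eq)

text \<open>By \<open>1 - x <= exp (- x)\<close> at \<open>x = 1/k\<close>, since \<open>T/k\<close>
  is at least the logarithm of the inverse bound.\<close>

lemma decay_T: "(1 - 1 / real k) ^ T \<le> 2 * real k * (2 * real k + 1) / (real n)\<^sup>2"
proof -
  let ?q = "(real n)\<^sup>2 / (2 * real k * (2 * real k + 1))"
  have k: "0 < real k" using k_ge_2 by simp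
  have "(1 - 1 / real k) ^ T \<le> exp (- 1 / real k) ^ T"
    using k k_ge_2 exp_ge_add_one_self[of "- 1 / real k"] by (intro power_mono) auto
  also have "\<dots> = exp (- (real T / real k))" by (simp flip: exp_of_nat_mult)
  also have "\<dots> \<le> exp (- ln ?q)"
    using T_ge k by (simp add: field_simps)
  also have "\<dots> = 1 / ?q" using ratio_gt_1 by (simp add: exp_minus inverse_eq_divide)
  finally show ?thesis by simp
qed

text \<open>By \<open>th_eq\<close> and \<open>decay_T\<close>, \<open>T\<close> rounds of geometric
  decay already reach \<open>th\<close>. So comparing with \<open>th\<close> enforces the bound on
  the number of centers without computing \<open>T\<close>.\<close>

lemma steps_less_T:
  assumes "t \<le> al + (1 - 1 / real k) ^ r * (real n * cap - al)" and "th < t"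
  shows "r < T"
proof (rule ccontr)
  assume "\<not> r < T"
  then have "(1 - 1 / real k) ^ r \<le> (1 - 1 / real k) ^ T"
    using k_ge_2 by (intro power_decreasing) auto
  also note decay_T
  finally have "(1 - 1 / real k) ^ r * (real n * cap - al) \<le>
      2 * real k * (2 * real k + 1) / (real n)\<^sup>2 * (real n * cap - al)"
    using n_cap al_bounds by (intro mult_right_mono) auto
  with assms th_eq show False by linarith
qed

lemma k_ln_ge_2: "2 \<le> real k * ln (real n / real k)"
proof -
  have "1 \<le> ln (3::real)" using exp_le by (simp add: ln_ge_iff)
  also have "\<dots> \<le> ln (real n / real k)"
    using k_ge_2 n_ge by (subst ln_le_cancel_iff) (auto simp: field_simps)
  finally have "2 * 1 \<le> real k * ln (real n / real k)"
    using k_ge_2 by (intro mult_mono) auto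
  then show ?thesis by simp
qed

text \<open>Replacing \<open>2k(2k+1)\<close> by \<open>k^2\<close> makes the argument of the
  logarithm a square, which gives the factor 2. The two units for the ceiling and for
  \<open>+ 1\<close> are absorbed by \<open>k_ln_ge_2\<close>.\<close>

lemma T_le: "real T + 1 \<le> 3 * (real k * ln (real n / real k))"
proof -
  let ?q = "(real n)\<^sup>2 / (2 * real k * (2 * real k + 1))"
  have k: "0 < real k" "0 < real n" using k_ge_2 n_ge by auto
  have "?q \<le> (real n)\<^sup>2 / (real k)\<^sup>2"
    using k by (intro divide_left_mono mult_pos_pos) (auto simp: power2_eq_square algebra_simps)
  then have "ln ?q \<le> ln ((real n / real k)\<^sup>2)"
    using ratio_gt_1 k by (subst ln_le_cancel_iff) (auto simp: power_divide)
  also have "\<dots> = 2 * ln (real n / real k)" using k by (simp add: ln_realpow)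
  finally have "real k * ln ?q \<le> 2 * (real k * ln (real n / real k))"
    using k by simp
  moreover have "real T < real k * ln ?q + 1"
    using T_eq center_bound_eq
    by (metis ceiling_correct diff_less_eq of_int_of_nat_eq)
  ultimately show ?thesis using k_ln_ge_2 by linarith
qed

\<comment> \<open>gain of center \<open>i\<close> over the first \<open>r\<close> edges of the list\<close>
definition gain :: "(nat \<Rightarrow> real) \<Rightarrow> real \<Rightarrow> nat \<Rightarrow> nat \<Rightarrow> real" where
  "gain cur mu r i = (\<Sum>e<r. if cen e = i then max 0 (cur (cus e) - al * cst e * mu) else 0)"

lemma gain_0 [simp]: "gain cur mu 0 i = 0"
  by (simp add: gain_def)

lemma gain_Suc: "gain cur mu (Suc r) i =
    gain cur mu r i + (if cen r = i then max 0 (cur (cus r) - al * cst r * mu) else 0)"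
  by (simp add: gain_def)

lemma gain_mono: "r \<le> r' \<Longrightarrow> gain cur mu r i \<le> gain cur mu r' i"
  unfolding gain_def by (intro sum_mono2) auto

section \<open>LP lower bounds from small gains\<close>

definition cert :: "real \<Rightarrow> bool" where
  "cert mu \<longleftrightarrow> (mu = 0 \<longrightarrow> lp_opt G = \<infinity>) \<and> (0 < mu \<longrightarrow> ennreal (1 / mu) \<le> lp_opt G)"

text \<open>This is the averaging over a center drawn with weights \<open>x\<close>, as an
  inequality of sums. The \<open>y\<close> values of a customer sum to 1, so \<open>cur\<close>
  spreads over the edges; on each edge \<open>y <= x\<close> bounds a positive excess, and a
  negative one is dropped.\<close>

lemma lp_gain_average:
  assumes lp: "lp_feasible G x y" and mu: "0 \<le> mu"
  shows "(\<Sum>j<n. cur j) - al * mu * (\<Sum>(i, j)\<in>edges G. cost G i j * y i j) \<le>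
    (\<Sum>i\<in>centers G. x i * gain cur mu m i)"
proof -
  let ?w = "\<lambda>e. al * cst e * mu"
  have "(\<Sum>j<n. cur j) = (\<Sum>j<n. \<Sum>i | (i, j) \<in> edges G. y i j * cur j)"
    using lp by (intro sum.cong) (auto simp: lp_feasible_def customers_eq simp flip: sum_distrib_right)
  also have "\<dots> = (\<Sum>j<n. \<Sum>p | p \<in> edges G \<and> snd p = j. y (fst p) (snd p) * cur (snd p))"
    by (intro sum.cong refl sum.reindex_bij_witness[where i = fst and j = "\<lambda>i. (i, _)"]) auto
  also have "\<dots> = (\<Sum>p\<in>edges G. y (fst p) (snd p) * cur (snd p))"
    using edges_sub customers_eq finite_edges by (intro sum.group) auto
  also have "\<dots> = (\<Sum>e<m. y (cen e) (cus e) * cur (cus e))"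
    using sum_nth_eq_sum_set[OF distinct_es, of "\<lambda>p. y (fst p) (snd p) * cur (snd p)"] set_es by simp
  finally have cur: "(\<Sum>j<n. cur j) = (\<Sum>e<m. y (cen e) (cus e) * cur (cus e))" .
  have "al * mu * (\<Sum>(i, j)\<in>edges G. cost G i j * y i j) =
      al * mu * (\<Sum>e<m. cst e * y (cen e) (cus e))"
    using sum_nth_eq_sum_set[OF distinct_es, of "\<lambda>p. cost G (fst p) (snd p) * y (fst p) (snd p)"] set_es
    by (simp add: case_prod_unfold)
  also have "\<dots> = (\<Sum>e<m. y (cen e) (cus e) * ?w e)"
    by (simp add: sum_distrib_left algebra_simps)
  finally have "(\<Sum>j<n. cur j) - al * mu * (\<Sum>(i, j)\<in>edges G. cost G i j * y i j) =
      (\<Sum>e<m. y (cen e) (cus e) * (cur (cus e) - ?w e))"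
    using cur by (simp add: sum_subtractf algebra_simps)
  also have "\<dots> \<le> (\<Sum>e<m. x (cen e) * max 0 (cur (cus e) - ?w e))"
  proof (rule sum_mono)
    fix e assume "e \<in> {..<m}"
    then have "0 \<le> y (cen e) (cus e)" "y (cen e) (cus e) \<le> x (cen e)"
      using lp edge_in[of e] by (auto simp: lp_feasible_def)
    then show "y (cen e) (cus e) * (cur (cus e) - ?w e) \<le> x (cen e) * max 0 (cur (cus e) - ?w e)"
      by (meson max.cobounded1 max.cobounded2 mult_left_mono mult_right_mono order_trans)
  qed
  also have "\<dots> = (\<Sum>e<m. \<Sum>i\<in>centers G. if cen e = i then x i * max 0 (cur (cus e) - ?w e) else 0)"
    using cen_in finite_centers by (intro sum.cong) auto
  also have "\<dots> = (\<Sum>i\<in>centers G. \<Sum>e<m. if cen e = i then x i * max 0 (cur (cus e) - ?w e) else 0)"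
    by (rule sum.swap)
  also have "\<dots> = (\<Sum>i\<in>centers G. x i * gain cur mu m i)"
    unfolding gain_def sum_distrib_left by (intro sum.cong) auto
  finally show ?thesis .
qed

text \<open>A feasible solution of value at most \<open>1/mu\<close> would make the
  \<open>x\<close>-weighted sum of gains at least \<open>tot - al\<close>. As the weights sum to
  \<open>k\<close>, some gain would be at least \<open>(tot - al)/k\<close>. At
  \<open>mu = 0\<close> the value condition holds for every solution, so none is feasible.\<close>

lemma no_gain_cert:
  assumes mu: "0 \<le> mu" and tot: "tot = (\<Sum>j<n. cur j)" "al < tot"
    and small: "\<And>e. e < m \<Longrightarrow> gain cur mu m (cen e) < (tot - al) / real k"
  shows "cert mu"
proof -
  have k: "0 < real k" using k_ge_2 by simp
  have large: "1 < mu * (\<Sum>(i, j)\<in>edges G. cost G i j * y i j)" if lp: "lp_feasible G x y" for x y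
  proof (rule ccontr)
    let ?V = "\<Sum>(i, j)\<in>edges G. cost G i j * y i j"
    assume "\<not> 1 < mu * ?V"
    then have "al * mu * ?V \<le> al"
      using al_bounds by (simp add: mult.assoc mult_left_le)
    with lp_gain_average[OF lp mu, of cur] tot
    have ge: "tot - al \<le> (\<Sum>i\<in>centers G. x i * gain cur mu m i)" by linarith
    \<comment> \<open>\<open>small\<close> speaks of endpoints of edges only; an isolated center
      gains 0, which is below the positive threshold.\<close>
    have less: "gain cur mu m i < (tot - al) / real k" for i
    proof (cases "\<exists>e<m. cen e = i")
      case True with small show ?thesis by blast
    next
      case False
      then have "gain cur mu m i = 0" by (auto simp: gain_def intro!: sum.neutral)
      with tot k show ?thesis by simp
    qed
    have x: "\<forall>i\<in>centers G. 0 \<le> x i" "(\<Sum>i\<in>centers G. x i) = real k"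
      using lp by (auto simp: lp_feasible_def)
    \<comment> \<open>Strictness of the weighted sum needs one positive weight, which exists as the
      weights sum to \<open>k > 0\<close>.\<close>
    then obtain i0 where i0: "i0 \<in> centers G" "0 < x i0"
      using k by (metis less_eq_real_def order.irrefl sum.neutral)
    have "(\<Sum>i\<in>centers G. x i * gain cur mu m i) < (\<Sum>i\<in>centers G. x i * ((tot - al) / real k))"
      using x less i0 finite_centers
      by (intro sum_strict_mono_ex1 ballI mult_left_mono bexI[of _ i0] mult_strict_left_mono)
        (auto intro: less_imp_le)
    also have "\<dots> = tot - al"
      using x k by (simp only: sum_distrib_right[symmetric]) simp
    finally show False using ge by simp
  qed
  show ?thesis
  proof (cases "mu = 0")
    case True
    with large have "\<not> lp_feasible G x y" for x y by force
    with True show ?thesis by (simp add: cert_def lp_opt_def)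
  next
    case False
    with mu have "0 < mu" by simp
    have "ennreal (1 / mu) \<le> lp_opt G"
      unfolding lp_opt_def
    proof (rule Inf_greatest, clarify)
      fix x y assume "lp_feasible G x y"
      from large[OF this] \<open>0 < mu\<close>
      show "ennreal (1 / mu) \<le> ennreal (\<Sum>(i, j)\<in>edges G. cost G i j * y i j)"
        by (intro ennreal_leI) (simp add: field_simps)
    qed
    with False show ?thesis by (simp add: cert_def)
  qed
qed

\<comment> \<open>\<open>cur j\<close> need not be the capped cost of customer \<open>j\<close>, only an upper bound with a witness\<close>
definition cov :: "real \<Rightarrow> nat set \<Rightarrow> (nat \<Rightarrow> real) \<Rightarrow> bool" where
  "cov mu C cur \<longleftrightarrow> (\<forall>j<n. 0 \<le> cur j \<and> cur j \<le> cap \<and>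
     (cur j = cap \<or> (\<exists>i\<in>C. (i, j) \<in> edges G \<and> cur j = al * cost G i j * mu)))"

section \<open>What greedy runs guarantee about capped costs\<close>

definition good :: "real \<Rightarrow> nat set \<Rightarrow> bool" where
  "good mu C \<longleftrightarrow> C \<subseteq> centers G \<and> card C \<le> T \<and> (\<exists>cur. cov mu C cur \<and> (\<Sum>j<n. cur j) \<le> th)"

text \<open>Distinct edges at the same center lead to distinct customers, so no customer's decrease
  is counted twice.\<close>

lemma gain_le_decrease:
  assumes "\<And>j. j < n \<Longrightarrow> cur' j \<le> cur j"
    and "\<And>e. e < m \<Longrightarrow> cen e = b \<Longrightarrow> cur' (cus e) \<le> al * cst e * mu"
  shows "gain cur mu m b \<le> (\<Sum>j<n. cur j) - (\<Sum>j<n. cur' j)"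
proof -
  let ?E = "{e\<in>{..<m}. cen e = b}"
  have inj: "inj_on cus ?E"
    using distinct_es by (auto intro!: inj_onI simp: prod_eq_iff simp flip: nth_eq_iff_index_eq)
  have "gain cur mu m b = (\<Sum>e\<in>?E. max 0 (cur (cus e) - al * cst e * mu))"
    unfolding gain_def by (rule sum.inter_filter[symmetric]) simp
  also have "\<dots> \<le> (\<Sum>e\<in>?E. cur (cus e) - cur' (cus e))"
    using assms cus_less by (intro sum_mono) force
  also have "\<dots> = (\<Sum>j\<in>cus ` ?E. cur j - cur' j)"
    by (subst sum.reindex[OF inj]) (simp add: comp_def)
  also have "\<dots> \<le> (\<Sum>j<n. cur j - cur' j)"
    using assms(1) cus_less by (intro sum_mono2) auto
  finally show ?thesis by (simp add: sum_subtractf)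
qed

text \<open>Zero costs are listed separately because they are free even at \<open>L = 0\<close>, by
  \<open>0 / 0 = 0\<close>; a positive cost needs \<open>0 < L\<close> for the real quotient to
  agree with the extended one.\<close>

lemma capped_cost_less_1:
  assumes L: "0 \<le> L" and v: "(\<Sum>j<n. v j) < 1"
    and vj: "\<And>j. j < n \<Longrightarrow> 0 \<le> v j \<and> (cap \<le> v j \<or>
      (\<exists>i\<in>C. (i, j) \<in> edges G \<and> (cost G i j = 0 \<or> 0 < L \<and> al * cost G i j / L \<le> v j)))"
  shows "capped_cost G (ennreal L) C < 1"
proof -
  have "capped_cost_of G (ennreal L) C j \<le> ennreal (v j)" if j: "j < n" for j
  proof (cases "cap \<le> v j")
    case True
    then show ?thesis
      by (auto simp: capped_cost_of_def Let_def cap_def intro!: min.coboundedI1 ennreal_leI)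
  next
    case False
    with vj[OF j] obtain i where i: "i \<in> C" "(i, j) \<in> edges G"
      "cost G i j = 0 \<or> 0 < L \<and> al * cost G i j / L \<le> v j" by auto
    have "ennreal al * ((INF i \<in> C. ext_cost G i j) / ennreal L) \<le> ennreal al * (ennreal (cost G i j) / ennreal L)"
      using i by (intro mult_left_mono divide_right_mono_ennreal INF_lower2[OF i(1)]) (auto simp: ext_cost_def)
    also have "\<dots> \<le> ennreal (v j)"
    proof (cases "cost G i j = 0")
      case True then show ?thesis by simp
    next
      case False
      with i have "0 < L" "al * cost G i j / L \<le> v j" by auto
      with cost_nonneg[OF i(2)] al_bounds show ?thesis
        by (simp add: divide_ennreal ennreal_leI flip: ennreal_mult)
    qed
    finally show ?thesis
      by (auto simp: capped_cost_of_def Let_def al_def num_customers_def n_def[symmetric] intro: min.coboundedI2)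
  qed
  then have "capped_cost G (ennreal L) C \<le> (\<Sum>j<n. ennreal (v j))"
    unfolding capped_cost_def customers_eq by (intro sum_mono) auto
  also have "\<dots> = ennreal (\<Sum>j<n. v j)" using vj by (intro sum_ennreal) auto
  also have "\<dots> < 1" using v by (simp add: ennreal_less_one_iff)
  finally show ?thesis .
qed

text \<open>A cost with \<open>mu * cost >= 1\<close> would give
  \<open>cur >= al >= 1/3 > cap\<close>, so every witness edge is cheap. Relative to
  \<open>L\<close> it contributes at most \<open>1/n^3\<close>; all customers together add
  \<open>1/n^2\<close>, less than the slack. With \<open>L = 0\<close> the cheap edges have cost
  0.\<close>

lemma capped_cost_gap:
  assumes good: "good mu C" and L: "0 \<le> L"
    and costs: "\<And>e. e < m \<Longrightarrow> cst e \<le> L / real n ^ 3 \<or> 1 \<le> mu * cst e"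
  shows "capped_cost G (ennreal L) C < 1"
proof -
  from good obtain cur where cov: "cov mu C cur" and sum: "(\<Sum>j<n. cur j) \<le> th"
    by (auto simp: good_def)
  let ?v = "\<lambda>j. cur j + 1 / real n ^ 3"
  have n: "0 < real n" using n_ge_6 by simp
  show ?thesis
  proof (rule capped_cost_less_1[OF L, of ?v])
    have "(\<Sum>j<n. ?v j) = (\<Sum>j<n. cur j) + 1 / (real n)\<^sup>2"
      using n by (simp add: sum.distrib power3_eq_cube power2_eq_square)
    moreover have "1 / (real n)\<^sup>2 < 6 / (real n)\<^sup>2" using n by (simp add: divide_strict_right_mono)
    ultimately show "(\<Sum>j<n. ?v j) < 1" using slack sum by linarith
  next
    fix j assume j: "j < n"
    with cov have cj: "0 \<le> cur j" "cur j \<le> cap" by (auto simp: cov_def)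
    show "0 \<le> ?v j \<and> (cap \<le> ?v j \<or>
      (\<exists>i\<in>C. (i, j) \<in> edges G \<and> (cost G i j = 0 \<or> 0 < L \<and> al * cost G i j / L \<le> ?v j)))"
    proof (cases "cur j = cap")
      case True then show ?thesis using cj n by simp
    next
      case False
      with cov j obtain i where i: "i \<in> C" "(i, j) \<in> edges G" "cur j = al * cost G i j * mu"
        by (auto simp: cov_def)
      have "\<not> 1 \<le> mu * cost G i j"
      proof
        assume "1 \<le> mu * cost G i j"
        then have "al * 1 \<le> al * (mu * cost G i j)" using al_bounds by (intro mult_left_mono) auto
        also have "\<dots> = cur j" using i by simp
        finally show False using cj cap_bounds al_bounds by simp
      qed
      with costs edge_index[OF i(2)] have c: "cost G i j \<le> L / real n ^ 3" by auto
      have "cost G i j = 0 \<or> 0 < L \<and> al * cost G i j / L \<le> ?v j"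
      proof (cases "L = 0")
        case True with c cost_nonneg[OF i(2)] show ?thesis by simp
      next
        case False
        have "al * cost G i j \<le> 1 * (L / real n ^ 3)"
          using c al_bounds cost_nonneg[OF i(2)] by (intro mult_mono) auto
        then have "al * cost G i j / L \<le> 1 / real n ^ 3"
          using False L n by (simp add: field_simps)
        with False L cj show ?thesis by simp
      qed
      with i cj show ?thesis by auto
    qed
  qed
qed

text \<open>\<open>1/L\<close> is at most \<open>mu\<close> times \<open>1 + a\<close> with
  \<open>a = 1/n^2\<close>, so the sum is at most \<open>(1 - 6 a) (1 + a)\<close>, which is below
  1.\<close>

lemma capped_cost_close:
  assumes good: "good mu C" and L: "0 < L" and mu: "0 < mu"
    and close: "1 / mu - L \<le> L / (real n)\<^sup>2"
  shows "capped_cost G (ennreal L) C < 1"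
proof -
  from good obtain cur where cov: "cov mu C cur" and sum: "(\<Sum>j<n. cur j) \<le> th"
    by (auto simp: good_def)
  let ?a = "1 / (real n)\<^sup>2"
  let ?v = "\<lambda>j. cur j * (1 + ?a)"
  have a: "0 < ?a" using n_ge_6 by simp
  have ratio: "1 / L \<le> mu * (1 + ?a)"
    using close L mu by (simp add: field_simps)
  show ?thesis
  proof (rule capped_cost_less_1[of _ ?v])
    have "(\<Sum>j<n. ?v j) = (\<Sum>j<n. cur j) * (1 + ?a)" by (simp add: sum_distrib_right)
    also have "\<dots> \<le> (1 - 6 * ?a) * (1 + ?a)"
      using sum slack a by (intro mult_right_mono) auto
    also have "\<dots> < 1"
    proof -
      have "(1 - 6 * a) * (1 + a) < 1" if "0 < a" for a :: real
        using that by (simp add: algebra_simps add_pos_pos)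
      from this[OF a] show ?thesis .
    qed
    finally show "(\<Sum>j<n. ?v j) < 1" .
  next
    fix j assume j: "j < n"
    with cov have cj: "0 \<le> cur j" by (auto simp: cov_def)
    then have le: "cur j \<le> ?v j" using a by (simp add: algebra_simps)
    show "0 \<le> ?v j \<and> (cap \<le> ?v j \<or>
      (\<exists>i\<in>C. (i, j) \<in> edges G \<and> (cost G i j = 0 \<or> 0 < L \<and> al * cost G i j / L \<le> ?v j)))"
    proof (cases "cur j = cap")
      case True then show ?thesis using cj le by simp
    next
      case False
      with cov j obtain i where i: "i \<in> C" "(i, j) \<in> edges G" "cur j = al * cost G i j * mu"
        by (auto simp: cov_def)
      have "(al * cost G i j) * (1 / L) \<le> (al * cost G i j) * (mu * (1 + ?a))"
        using ratio al_bounds cost_nonneg[OF i(2)] by (intro mult_left_mono) auto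
      also have "\<dots> = ?v j" using i by simp
      finally show ?thesis using i cj le L by auto
    qed
  qed (use L in simp)
qed

end

section \<open>The greedy program\<close>

abbreviation cen_exp :: nexp where "cen_exp \<equiv> NArr ''center'' (NReg ''e'')"
abbreviation cus_exp :: nexp where "cus_exp \<equiv> NArr ''customer'' (NReg ''e'')"

definition set_excess :: com where
  "set_excess = RSet ''d'' (RSub (RArr ''cur'' cus_exp)
     (RMul (RMul (RReg ''al'') (RArr ''cost'' (NReg ''e''))) (RReg ''mu'')))"

definition init_cur :: com where
  "init_cur = For ''j'' ''n'' (RStore ''cur'' (NReg ''j'') (RReg ''cap''))"

text \<open>Entries are reset along the edges, not the centers: isolated centers may outnumber the
  edges, and each round must cost \<open>O(m)\<close>.\<close>

definition clear_gains :: com where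
  "clear_gains = For ''e'' ''m'' (RStore ''gain'' cen_exp (RNat (NConst 0)))"

\<comment> \<open>Testing the partial sums suffices, as they only grow while a center's edges are added.\<close>
definition add_gains :: com where
  "add_gains = For ''e'' ''m''
     (set_excess ;;
      Cond (RLess (RNat (NConst 0)) (RReg ''d''))
        (RStore ''gain'' cen_exp (RAdd (RArr ''gain'' cen_exp) (RReg ''d'')) ;;
         Cond (RLess (RArr ''gain'' cen_exp) (RReg ''thr'')) Skip
           (NSet ''f'' (NConst 1) ;; NSet ''b'' cen_exp))
        Skip)"

definition lower_cur :: com where
  "lower_cur = For ''e'' ''m''
     (Cond (TAnd (TNot (NLess cen_exp (NReg ''b''))) (TNot (NLess (NReg ''b'') cen_exp)))
        (set_excess ;;
         Cond (RLess (RNat (NConst 0)) (RReg ''d''))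
           (RStore ''cur'' cus_exp (RSub (RArr ''cur'' cus_exp) (RReg ''d'')) ;;
            RSet ''tot'' (RSub (RReg ''tot'') (RReg ''d'')))
           Skip)
        Skip)"

text \<open>Greedy collects its centers in \<open>D\<close>. Only a success is copied to
  \<open>C\<close>, so a failed run leaves the last successful set intact.\<close>

definition copy_centers :: com where
  "copy_centers = For ''e'' ''sz'' (NStore ''C'' (NReg ''e'') (NArr ''D'' (NReg ''e'')))"

definition greedy_step :: com where
  "greedy_step =
     RSet ''thr'' (RDiv (RSub (RReg ''tot'') (RReg ''al'')) (RNat (NReg ''k''))) ;;
     clear_gains ;;
     NSet ''f'' (NConst 0) ;;
     add_gains ;;
     Cond (NLess (NConst 0) (NReg ''f''))
       (NStore ''D'' (NReg ''sz'') (NReg ''b'') ;;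
        NSet ''sz'' (NAdd (NReg ''sz'') (NConst 1)) ;;
        lower_cur)
       (NSet ''ok'' (NConst 0))"

definition greedy :: com where
  "greedy =
     init_cur ;;
     RSet ''tot'' (RMul (RNat (NReg ''n'')) (RReg ''cap'')) ;;
     NSet ''sz'' (NConst 0) ;;
     NSet ''ok'' (NConst 1) ;;
     While (TAnd (RLess (RReg ''th'') (RReg ''tot'')) (NLess (NConst 0) (NReg ''ok''))) greedy_step"

\<comment> \<open>At \<open>mu = 0\<close> a failure sets \<open>lambda\<close> to the junk value \<open>1 / 0 = 0\<close>; \<open>solve\<close> then sets the flag \<open>infinite\<close>.\<close>
definition probe :: com where
  "probe =
     greedy ;;
     Cond (NLess (NConst 0) (NReg ''ok''))
       (copy_centers ;; NSet ''size'' (NReg ''sz'') ;; RSet ''mus'' (RReg ''mu''))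
       (RSet ''lambda'' (RDiv (RNat (NConst 1)) (RReg ''mu'')))"

lemmas greedy_defs = set_excess_def init_cur_def clear_gains_def add_gains_def lower_cur_def
  copy_centers_def greedy_step_def

lemma greedy_step_vars:
  "nregs greedy_step = {''e'', ''f'', ''b'', ''sz'', ''ok''}"
  "rregs greedy_step = {''d'', ''thr'', ''tot''}"
  "narrs greedy_step = {''D''}"
  "rarrs greedy_step = {''cur'', ''gain''}"
  by (auto simp: greedy_defs)

lemma greedy_vars:
  "nregs greedy = {''e'', ''f'', ''b'', ''sz'', ''ok'', ''j''}"
  "rregs greedy = {''d'', ''thr'', ''tot''}"
  "narrs greedy = {''D''}"
  "rarrs greedy = {''cur'', ''gain''}"
  by (auto simp: greedy_def greedy_step_vars init_cur_def)

lemma probe_vars: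
  "nregs probe = {''e'', ''f'', ''b'', ''sz'', ''ok'', ''j'', ''size''}"
  "rregs probe = {''d'', ''thr'', ''tot'', ''mus'', ''lambda''}"
  "narrs probe = {''D'', ''C''}"
  "rarrs probe = {''cur'', ''gain''}"
  by (auto simp: probe_def greedy_vars copy_centers_def)

lemma sum_fun_upd_lessThan:
  fixes f :: "nat \<Rightarrow> real"
  assumes "c < n"
  shows "(\<Sum>j<n. (f(c := v)) j) = (\<Sum>j<n. f j) - f c + v"
proof -
  have "(\<Sum>j\<in>{..<n} - {c}. (f(c := v)) j) = (\<Sum>j\<in>{..<n} - {c}. f j)"
    by (intro sum.cong) auto
  with assms show ?thesis
    by (simp add: sum.remove[of "{..<n}" c])
qed

context greedy_instance
begin

section \<open>Correctness and cost of the greedy program\<close>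

definition inp :: "store \<Rightarrow> bool" where
  "inp s \<longleftrightarrow> nreg s ''k'' = k \<and> nreg s ''n'' = n \<and> nreg s ''m'' = m \<and>
     (\<forall>e<m. narr s ''center'' e = cen e \<and> narr s ''customer'' e = cus e \<and> rarr s ''cost'' e = cst e)"

definition par :: "store \<Rightarrow> bool" where
  "par s \<longleftrightarrow> inp s \<and> rreg s ''al'' = al \<and> rreg s ''cap'' = cap \<and> rreg s ''th'' = th"

lemma par_unchanged:
  assumes "par s" "unchanged P s s'"
    "nregs P \<inter> {''k'', ''n'', ''m''} = {}" "rregs P \<inter> {''al'', ''cap'', ''th''} = {}"
    "narrs P \<inter> {''center'', ''customer''} = {}" "''cost'' \<notin> rarrs P"
  shows "par s'"
  using assms unfolding par_def inp_def unchanged_def by (auto simp: disjoint_iff)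

lemma runs_init_cur:
  assumes "par s" "\<And>s'. (\<forall>j<n. rarr s' ''cur'' j = cap) \<Longrightarrow> unchanged init_cur s s' \<Longrightarrow> Q s'"
    "n * 3 + 2 \<le> N"
  shows "runs init_cur s N Q"
  unfolding init_cur_def
proof (rule runs_For[where B = 1 and M = n and J = "\<lambda>i s'. \<forall>j<i. rarr s' ''cur'' j = cap"])
  show "nreg s ''n'' = n" using assms by (simp add: par_def inp_def)
  fix s' assume "\<forall>j<n. rarr s' ''cur'' j = cap"
    "unchanged (For ''j'' ''n'' (RStore ''cur'' (NReg ''j'') (RReg ''cap''))) s s'"
  then show "Q s'" using assms by (simp add: init_cur_def)
qed (use assms in \<open>auto simp: unchanged_def par_def less_Suc_eq\<close>)

lemma runs_clear_gains:
  assumes "par s" "\<And>s'. (\<forall>e<m. rarr s' ''gain'' (cen e) = 0) \<Longrightarrow> unchanged clear_gains s s' \<Longrightarrow> Q s'"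
    "m * 3 + 2 \<le> N"
  shows "runs clear_gains s N Q"
  unfolding clear_gains_def
proof (rule runs_For[where B = 1 and M = m and J = "\<lambda>i s'. \<forall>e<i. rarr s' ''gain'' (cen e) = 0"])
  show "nreg s ''m'' = m" using assms by (simp add: par_def inp_def)
  fix s' assume "\<forall>e<m. rarr s' ''gain'' (cen e) = 0"
    "unchanged (For ''e'' ''m'' (RStore ''gain'' cen_exp (RNat (NConst 0)))) s s'"
  then show "Q s'" using assms by (simp add: clear_gains_def)
qed (use assms in \<open>auto simp: unchanged_def par_def inp_def less_Suc_eq\<close>)

text \<open>A recorded center \<open>b\<close> remains a witness for the full sum by
  \<open>gain_mono\<close>. While the flag is 0, only the center of the current edge needs a new
  test.\<close>

lemma runs_add_gains:
  assumes par: "par s" and thr: "0 < rreg s ''thr''" and f: "nreg s ''f'' = 0"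
    and zero: "\<forall>e<m. rarr s ''gain'' (cen e) = 0"
    and cur: "cur = rarr s ''cur''" and mu: "mu = rreg s ''mu''"
    and Q: "\<And>s'. (if nreg s' ''f'' = 0 then \<forall>e<m. gain cur mu m (cen e) < rreg s ''thr''
        else \<exists>e<m. nreg s' ''b'' = cen e \<and> rreg s ''thr'' \<le> gain cur mu m (cen e)) \<Longrightarrow>
        unchanged add_gains s s' \<Longrightarrow> Q s'"
    and N: "m * 8 + 2 \<le> N"
  shows "runs add_gains s N Q"
proof -
  define J where "J r s' \<longleftrightarrow> (\<forall>e<m. rarr s' ''gain'' (cen e) = gain cur mu r (cen e)) \<and>
     (if nreg s' ''f'' = 0 then \<forall>e<m. gain cur mu r (cen e) < rreg s ''thr''
      else \<exists>e<m. nreg s' ''b'' = cen e \<and> rreg s ''thr'' \<le> gain cur mu r (cen e))" for r and s' :: store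
  show ?thesis
    unfolding add_gains_def
  proof (rule runs_For[where B = 6 and M = m and J = J], goal_cases)
    case 1 then show ?case using zero thr f by (simp add: J_def)
  next
    case 2 then show ?case using par by (simp add: par_def inp_def)
  next
    case (6 i s')
    let ?d = "cur (cus i) - al * cst i * mu"
    have s': "nreg s' ''e'' = i" "narr s' ''center'' i = cen i" "narr s' ''customer'' i = cus i"
      "rarr s' ''cost'' i = cst i" "rreg s' ''al'' = al" "rarr s' ''cur'' = cur" "rreg s' ''mu'' = mu"
      "rreg s' ''thr'' = rreg s ''thr''"
      using 6 par cur mu by (auto simp: par_def inp_def unchanged_def set_excess_def)
    have J: "\<forall>e<m. rarr s' ''gain'' (cen e) = gain cur mu i (cen e)"
      "if nreg s' ''f'' = 0 then \<forall>e<m. gain cur mu i (cen e) < rreg s ''thr''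
       else \<exists>e<m. nreg s' ''b'' = cen e \<and> rreg s ''thr'' \<le> gain cur mu i (cen e)"
      using 6 by (auto simp: J_def)
    have mono: "gain cur mu i x \<le> gain cur mu (Suc i) x" for x by (simp add: gain_mono)
    show ?case
    proof (cases "0 < ?d")
      case False
      then have "gain cur mu (Suc i) x = gain cur mu i x" for x by (auto simp: gain_Suc)
      with J False show ?thesis by (simp add: set_excess_def s' J_def)
    next
      case True
      then have g: "gain cur mu (Suc i) x = (if cen i = x then gain cur mu i x + ?d else gain cur mu i x)" for x
        by (auto simp: gain_Suc)
      have ci: "rarr s' ''gain'' (cen i) = gain cur mu i (cen i)" using J(1) 6(1) by blast
      let ?g = "rarr s' ''gain'' (cen i) + ?d"
      have J1: "\<forall>e<m. ((rarr s' ''gain'')(cen i := ?g)) (cen e) = gain cur mu (Suc i) (cen e)"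
        using J(1) by (simp add: g ci)
      have gi: "gain cur mu (Suc i) (cen i) = ?g" by (simp add: g ci)
      show ?thesis
      proof (cases "?g < rreg s ''thr''")
        case less: True
        have "if nreg s' ''f'' = 0 then \<forall>e<m. gain cur mu (Suc i) (cen e) < rreg s ''thr''
          else \<exists>e<m. nreg s' ''b'' = cen e \<and> rreg s ''thr'' \<le> gain cur mu (Suc i) (cen e)"
        proof (cases "nreg s' ''f'' = 0")
          case True
          have "gain cur mu (Suc i) (cen e) < rreg s ''thr''" if "e < m" for e
          proof (cases "cen e = cen i")
            case True
            then show ?thesis using gi less by metis
          next
            case False
            then show ?thesis using J(2) \<open>nreg s' ''f'' = 0\<close> that by (simp add: g)
          qed
          with True show ?thesis by simp
        next
          case False
          with J(2) mono show ?thesis by (auto intro: order_trans)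
        qed
        with True J1 less show ?thesis
          by (simp only: set_excess_def runs_Seq_RSet runs_Cond runs_Seq_RStore runs_Skip)
             (simp add: s' J_def)
      next
        case False
        have "\<exists>e<m. cen i = cen e \<and> rreg s ''thr'' \<le> gain cur mu (Suc i) (cen e)"
          using False gi 6(1) by (intro exI[of _ i]) simp
        with True J1 False show ?thesis
          by (simp only: set_excess_def runs_Seq_RSet runs_Cond runs_Seq_RStore runs_Seq_NSet runs_NSet)
             (simp add: s' J_def)
      qed
    qed
  next
    case (7 s')
    then show ?case using Q by (auto simp: J_def add_gains_def)
  qed (use N in \<open>auto simp: set_excess_def\<close>)
qed

text \<open>Each lowered entry equals the scaled cost of an edge at \<open>b\<close>, which becomes
  its witness in \<open>cov\<close>. At the end no edge at \<open>b\<close> has positive excess, so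
  \<open>gain_le_decrease\<close> applies.\<close>

lemma runs_lower_cur:
  assumes par: "par s" and mu: "rreg s ''mu'' = mu" "0 \<le> mu" and cov: "cov mu A (rarr s ''cur'')"
    and tot: "rreg s ''tot'' = (\<Sum>j<n. rarr s ''cur'' j)"
    and Q: "\<And>s'. cov mu (insert (nreg s ''b'') A) (rarr s' ''cur'') \<Longrightarrow>
        rreg s' ''tot'' = (\<Sum>j<n. rarr s' ''cur'' j) \<Longrightarrow>
        rreg s' ''tot'' \<le> rreg s ''tot'' - gain (rarr s ''cur'') mu m (nreg s ''b'') \<Longrightarrow>
        unchanged lower_cur s s' \<Longrightarrow> Q s'"
    and N: "m * 8 + 2 \<le> N"
  shows "runs lower_cur s N Q"
proof -
  let ?b = "nreg s ''b''"
  define J where "J r s' \<longleftrightarrow> cov mu (insert ?b A) (rarr s' ''cur'') \<and>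
     rreg s' ''tot'' = (\<Sum>j<n. rarr s' ''cur'' j) \<and>
     (\<forall>j<n. rarr s' ''cur'' j \<le> rarr s ''cur'' j) \<and>
     (\<forall>e<r. cen e = ?b \<longrightarrow> rarr s' ''cur'' (cus e) \<le> al * cst e * mu)" for r and s' :: store
  show ?thesis
    unfolding lower_cur_def
  proof (rule runs_For[where B = 6 and M = m and J = J], goal_cases)
    case 1 then show ?case using cov tot by (auto simp: J_def cov_def)
  next
    case 2 then show ?case using par by (simp add: par_def inp_def)
  next
    case (6 i s')
    have s': "nreg s' ''e'' = i" "narr s' ''center'' i = cen i" "narr s' ''customer'' i = cus i"
      "rarr s' ''cost'' i = cst i" "rreg s' ''al'' = al" "rreg s' ''mu'' = mu"
      "nreg s' ''b'' = ?b"
      using 6 par mu by (auto simp: par_def inp_def unchanged_def set_excess_def)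
    let ?c = "rarr s' ''cur''" and ?w = "al * cst i * mu"
    have J: "cov mu (insert ?b A) ?c" "rreg s' ''tot'' = (\<Sum>j<n. ?c j)"
      "\<forall>j<n. ?c j \<le> rarr s ''cur'' j" "\<forall>e<i. cen e = ?b \<longrightarrow> ?c (cus e) \<le> al * cst e * mu"
      using 6 by (auto simp: J_def)
    show ?case
    proof (cases "cen i = ?b \<and> ?w < ?c (cus i)")
      case False
      with J show ?thesis by (auto simp: set_excess_def s' J_def less_Suc_eq)
    next
      case True
      let ?c' = "?c(cus i := ?w)"
      have w: "0 \<le> ?w" using cst_nonneg[OF 6(1)] al_bounds mu by simp
      have "cov mu (insert ?b A) ?c'"
        using J(1) w True edge_in[OF 6(1)] cus_less[OF 6(1)] unfolding cov_def
        by (smt (verit) fun_upd_apply insertI1)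
      moreover have "(\<Sum>j<n. ?c' j) = rreg s' ''tot'' - (?c (cus i) - ?w)"
        using sum_fun_upd_lessThan[OF cus_less[OF 6(1)]] J(2) by simp
      moreover have "\<forall>j<n. ?c' j \<le> rarr s ''cur'' j" using J(3) True by force
      moreover have "\<forall>e<Suc i. cen e = ?b \<longrightarrow> ?c' (cus e) \<le> al * cst e * mu"
        using J(4) True by (force simp: less_Suc_eq)
      ultimately show ?thesis
        using conjunct1[OF True] conjunct2[OF True] by (simp add: set_excess_def s' J_def)
    qed
  next
    case (7 s')
    have "gain (rarr s ''cur'') mu m ?b \<le> (\<Sum>j<n. rarr s ''cur'' j) - (\<Sum>j<n. rarr s' ''cur'' j)"
      using 7 by (intro gain_le_decrease) (auto simp: J_def)
    with 7 Q tot show ?case by (auto simp: J_def lower_cur_def)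
  qed (use N in \<open>auto simp: set_excess_def\<close>)
qed

text \<open>The index bounds the rounds left through \<open>T <= sz + i\<close>; a failed round ends
  the loop and leaves a certificate instead. The bound on \<open>tot\<close> lets the excess over
  \<open>al\<close> decay by \<open>1 - 1/k\<close> per center.\<close>

definition greedy_inv :: "real \<Rightarrow> nat \<Rightarrow> store \<Rightarrow> bool" where
  "greedy_inv mu i s \<longleftrightarrow> par s \<and> rreg s ''mu'' = mu \<and>
     cov mu (narr s ''D'' ` {..<nreg s ''sz''}) (rarr s ''cur'') \<and>
     narr s ''D'' ` {..<nreg s ''sz''} \<subseteq> centers G \<and> nreg s ''sz'' \<le> T \<and>
     rreg s ''tot'' = (\<Sum>j<n. rarr s ''cur'' j) \<and>
     rreg s ''tot'' \<le> al + (1 - 1 / real k) ^ nreg s ''sz'' * (real n * cap - al) \<and>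
     (if 0 < nreg s ''ok'' then T \<le> nreg s ''sz'' + i else cert mu)"

lemma runs_greedy_step:
  assumes inv: "greedy_inv mu i s" and mu: "0 \<le> mu"
    and guard: "th < rreg s ''tot''" "0 < nreg s ''ok''"
  shows "0 < i \<and> runs greedy_step s (m * 19 + 12) (greedy_inv mu (i - 1))"
proof -
  let ?sz = "nreg s ''sz''" and ?tot = "rreg s ''tot''" and ?cur = "rarr s ''cur''"
  let ?A = "narr s ''D'' ` {..<?sz}" and ?thr = "(?tot - al) / real k"
  have par: "par s" and cov: "cov mu ?A ?cur" and A: "?A \<subseteq> centers G"
    and tot: "?tot = (\<Sum>j<n. ?cur j)"
    and decay: "?tot \<le> al + (1 - 1 / real k) ^ ?sz * (real n * cap - al)"
    and i: "T \<le> ?sz + i" and mu': "rreg s ''mu'' = mu"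
    using inv guard by (auto simp: greedy_inv_def)
  \<comment> \<open>The guard puts \<open>tot\<close> above \<open>th\<close>, so fewer than
    \<open>T\<close> centers have been chosen: one more is allowed, and rounds are left.\<close>
  have sz: "?sz < T" using steps_less_T[OF decay guard(1)] .
  with i have "0 < i" by simp
  have al_less: "al < ?tot" using guard al_less_th by simp
  have k: "0 < real k" using k_ge_2 by simp
  have thr: "0 < ?thr" using al_less k by simp
  have regs: "rreg s ''al'' = al" "nreg s ''k'' = k" using par by (auto simp: par_def inp_def)
  let ?s1 = "s\<lparr>rreg := (rreg s)(''thr'' := ?thr)\<rparr>"
  have par1: "par ?s1" using par by (simp add: par_def inp_def)
  have "runs (clear_gains ;; NSet ''f'' (NConst 0) ;; add_gains ;;
     Cond (NLess (NConst 0) (NReg ''f''))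
       (NStore ''D'' (NReg ''sz'') (NReg ''b'') ;;
        NSet ''sz'' (NAdd (NReg ''sz'') (NConst 1)) ;;
        lower_cur)
       (NSet ''ok'' (NConst 0))) ?s1 (11 + m * 19) (greedy_inv mu (i - 1))"
  proof (rule runs_Seq[where a = "m * 3 + 2" and b = "m * 16 + 9"], rule runs_clear_gains[OF par1])
    fix s2 assume zero: "\<forall>e<m. rarr s2 ''gain'' (cen e) = 0" and un2: "unchanged clear_gains ?s1 s2"
    have par2: "par s2" by (rule par_unchanged[OF par1 un2]) (auto simp: clear_gains_def)
    let ?s3 = "s2\<lparr>nreg := (nreg s2)(''f'' := 0)\<rparr>"
    have par3: "par ?s3" using par2 by (simp add: par_def inp_def)
    have s3: "rreg ?s3 ''thr'' = ?thr" "rreg ?s3 ''mu'' = mu" "rarr ?s3 ''cur'' = ?cur"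
      "nreg ?s3 ''sz'' = ?sz" "rreg ?s3 ''tot'' = ?tot" "narr ?s3 ''D'' = narr s ''D''"
      "nreg ?s3 ''ok'' = nreg s ''ok''"
      using un2 mu' by (auto simp: unchanged_def clear_gains_def)
    have "runs (add_gains ;;
     Cond (NLess (NConst 0) (NReg ''f''))
       (NStore ''D'' (NReg ''sz'') (NReg ''b'') ;;
        NSet ''sz'' (NAdd (NReg ''sz'') (NConst 1)) ;;
        lower_cur)
       (NSet ''ok'' (NConst 0))) ?s3 (8 + m * 16) (greedy_inv mu (i - 1))"
    proof (rule runs_Seq[where a = "m * 8 + 2" and b = "m * 8 + 6"],
        rule runs_add_gains[OF par3, where cur = ?cur and mu = mu])
      fix s4
      assume post: "if nreg s4 ''f'' = 0 then \<forall>e<m. gain ?cur mu m (cen e) < rreg ?s3 ''thr''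
        else \<exists>e<m. nreg s4 ''b'' = cen e \<and> rreg ?s3 ''thr'' \<le> gain ?cur mu m (cen e)"
        and un4: "unchanged add_gains ?s3 s4"
      have par4: "par s4"
        by (rule par_unchanged[OF par3 un4]) (auto simp: add_gains_def set_excess_def)
      have s4: "rreg s4 ''mu'' = mu" "rarr s4 ''cur'' = ?cur"
        "nreg s4 ''sz'' = ?sz" "rreg s4 ''tot'' = ?tot" "narr s4 ''D'' = narr s ''D''"
        "nreg s4 ''ok'' = nreg s ''ok''"
        using un4 s3 by (auto simp: unchanged_def add_gains_def set_excess_def)
      show "runs (Cond (NLess (NConst 0) (NReg ''f''))
         (NStore ''D'' (NReg ''sz'') (NReg ''b'') ;;
          NSet ''sz'' (NAdd (NReg ''sz'') (NConst 1)) ;;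
          lower_cur)
         (NSet ''ok'' (NConst 0))) s4 (m * 8 + 6) (greedy_inv mu (i - 1))"
      proof (cases "nreg s4 ''f'' = 0")
        case True
        with post s3 have "cert mu" by (intro no_gain_cert[OF mu tot al_less]) auto
        moreover have "par (s4\<lparr>nreg := (nreg s4)(''ok'' := 0)\<rparr>)"
          using par4 by (simp add: par_def inp_def)
        ultimately show ?thesis using True s4 inv by (simp add: greedy_inv_def)
      next
        case False
        with post s3 obtain e where e: "e < m" "nreg s4 ''b'' = cen e" "?thr \<le> gain ?cur mu m (cen e)"
          by auto
        let ?s5 = "s4\<lparr>narr := (narr s4)(''D'' := (narr s4 ''D'')(?sz := cen e)),
          nreg := (nreg s4)(''sz'' := Suc ?sz)\<rparr>"
        have par5: "par ?s5" using par4 by (simp add: par_def inp_def)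
        have D: "((narr s ''D'')(?sz := cen e)) ` {..<Suc ?sz} = insert (cen e) ?A"
          by (auto simp: lessThan_Suc)
        have "runs lower_cur ?s5 (3 + m * 8) (greedy_inv mu (i - 1))"
        proof (rule runs_lower_cur[OF par5, where mu = mu and A = ?A])
          fix s6
          assume 6: "cov mu (insert (nreg ?s5 ''b'') ?A) (rarr s6 ''cur'')"
            "rreg s6 ''tot'' = (\<Sum>j<n. rarr s6 ''cur'' j)"
            "rreg s6 ''tot'' \<le> rreg ?s5 ''tot'' - gain (rarr ?s5 ''cur'') mu m (nreg ?s5 ''b'')"
            and un6: "unchanged lower_cur ?s5 s6"
          have par6: "par s6"
            by (rule par_unchanged[OF par5 un6]) (auto simp: lower_cur_def set_excess_def)
          have s6: "rreg s6 ''mu'' = mu" "nreg s6 ''sz'' = Suc ?sz"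
            "narr s6 ''D'' = (narr s ''D'')(?sz := cen e)" "nreg s6 ''ok'' = nreg s ''ok''"
            using un6 s4 by (auto simp: unchanged_def lower_cur_def set_excess_def)
          \<comment> \<open>A gain of at least \<open>(tot - al)/k\<close> shrinks the excess over
            \<open>al\<close> by the factor \<open>1 - 1/k\<close>.\<close>
          have "rreg s6 ''tot'' \<le> ?tot - ?thr" using 6(3) e s4 by simp
          also have "\<dots> = al + (1 - 1 / real k) * (?tot - al)" using k by (simp add: field_simps)
          also have "\<dots> \<le> al + (1 - 1 / real k) * ((1 - 1 / real k) ^ ?sz * (real n * cap - al))"
            using decay k_ge_2 by (intro add_left_mono mult_left_mono) auto
          finally have "rreg s6 ''tot'' \<le> al + (1 - 1 / real k) ^ Suc ?sz * (real n * cap - al)"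
            by simp
          then show "greedy_inv mu (i - 1) s6"
            unfolding greedy_inv_def s6 D
            using 6(1,2) par6 s6 e A sz i guard \<open>0 < i\<close> cen_in[OF e(1)] by auto
        qed (use s4 mu cov tot in auto)
        then show ?thesis using False s4 e by simp
      qed
    qed (use s3 zero thr in auto)
    then show "runs (NSet ''f'' (NConst 0) ;; add_gains ;;
     Cond (NLess (NConst 0) (NReg ''f''))
       (NStore ''D'' (NReg ''sz'') (NReg ''b'') ;;
        NSet ''sz'' (NAdd (NReg ''sz'') (NConst 1)) ;;
        lower_cur)
       (NSet ''ok'' (NConst 0))) s2 (m * 16 + 9) (greedy_inv mu (i - 1))" by simp
  qed auto
  with \<open>0 < i\<close> show ?thesis by (simp add: greedy_step_def regs)
qed

lemma runs_greedy:
  assumes par: "par s" and mu: "rreg s ''mu'' = mu" "0 \<le> mu"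
    and N: "n * 3 + T * (m * 19 + 13) + 6 \<le> N"
  shows "runs greedy s N (\<lambda>s'. par s' \<and> rreg s' ''mu'' = mu \<and> nreg s' ''sz'' \<le> T \<and>
       (if 0 < nreg s' ''ok'' then good mu (narr s' ''D'' ` {..<nreg s' ''sz''}) else cert mu))"
    (is "runs _ _ _ ?R")
proof -
  let ?b = "TAnd (RLess (RReg ''th'') (RReg ''tot'')) (NLess (NConst 0) (NReg ''ok''))"
  show ?thesis
    unfolding greedy_def
  proof (rule runs_Seq[where a = "n * 3 + 2" and b = "T * (m * 19 + 13) + 4"],
      rule runs_init_cur[OF par])
    fix s1 assume cur: "\<forall>j<n. rarr s1 ''cur'' j = cap" and un1: "unchanged init_cur s s1"
    have par1: "par s1" by (rule par_unchanged[OF par un1]) (auto simp: init_cur_def)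
    have mu1: "rreg s1 ''mu'' = mu" using un1 mu by (simp add: unchanged_def init_cur_def)
    let ?s2 = "s1\<lparr>rreg := (rreg s1)(''tot'' := real n * cap),
      nreg := (nreg s1)(''sz'' := 0, ''ok'' := 1)\<rparr>"
    have "runs (While ?b greedy_step) ?s2 (T * (m * 19 + 13) + 1) ?R"
    proof (rule runs_While[where I = "greedy_inv mu" and i = T and B = "m * 19 + 12"])
      have "par ?s2" using par1 by (simp add: par_def inp_def)
      \<comment> \<open>At the start every customer is capped, which \<open>cov\<close> allows
        without any center.\<close>
      with cur mu1 cap_bounds show "greedy_inv mu T ?s2"
        by (auto simp: greedy_inv_def cov_def)
    next
      fix i s' assume "greedy_inv mu i s'" "teval ?b s'"
      then show "0 < i \<and> runs greedy_step s' (m * 19 + 12) (greedy_inv mu (i - 1))"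
        using mu by (intro runs_greedy_step) (auto simp: greedy_inv_def par_def)
    next
      fix i s' assume inv: "greedy_inv mu i s'" and exit: "\<not> teval ?b s'"
      have "card (narr s' ''D'' ` {..<nreg s' ''sz''}) \<le> nreg s' ''sz''"
        using card_image_le[of "{..<nreg s' ''sz''}"] by simp
      with inv exit show "?R s'"
        by (auto simp: greedy_inv_def good_def par_def)
    qed simp
    moreover have "nreg s1 ''n'' = n" "rreg s1 ''cap'' = cap" using par1 by (auto simp: par_def inp_def)
    ultimately show "runs (RSet ''tot'' (RMul (RNat (NReg ''n'')) (RReg ''cap'')) ;;
       NSet ''sz'' (NConst 0) ;; NSet ''ok'' (NConst 1) ;; While ?b greedy_step)
       s1 (T * (m * 19 + 13) + 4) ?R" by simp
  qed (use N in auto)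
qed

definition probe_post :: "real \<Rightarrow> store \<Rightarrow> store \<Rightarrow> bool" where
  "probe_post mu s s' \<longleftrightarrow>
     (if 0 < nreg s' ''ok''
      then good mu (narr s' ''C'' ` {..<nreg s' ''size''}) \<and> rreg s' ''mus'' = mu \<and>
        rreg s' ''lambda'' = rreg s ''lambda''
      else cert mu \<and> rreg s' ''lambda'' = 1 / mu \<and> rreg s' ''mus'' = rreg s ''mus'' \<and>
        nreg s' ''size'' = nreg s ''size'' \<and> narr s' ''C'' = narr s ''C'')"

lemma runs_copy_centers:
  "runs copy_centers s (nreg s ''sz'' * 3 + 2)
     (\<lambda>s'. \<forall>e<nreg s ''sz''. narr s' ''C'' e = narr s ''D'' e)"
  unfolding copy_centers_def
  by (rule runs_For[where B = 1 and J = "\<lambda>i s'. \<forall>e<i. narr s' ''C'' e = narr s ''D'' e"])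
    (auto simp: unchanged_def less_Suc_eq)

lemma runs_probe:
  assumes par: "par s" and mu: "rreg s ''mu'' = mu" "0 \<le> mu"
  shows "runs probe s (50 * m * (T + 1)) (probe_post mu s)"
  unfolding probe_def
proof (rule runs_Seq)
  let ?rest = "Cond (NLess (NConst 0) (NReg ''ok''))
     (copy_centers ;; NSet ''size'' (NReg ''sz'') ;; RSet ''mus'' (RReg ''mu''))
     (RSet ''lambda'' (RDiv (RNat (NConst 1)) (RReg ''mu'')))"
  show "runs greedy s (n * 3 + T * (m * 19 + 13) + 6) (\<lambda>s'. runs ?rest s' (T * 3 + 5) (probe_post mu s))"
  proof (rule runs_mono[OF runs_unchanged[OF runs_greedy[OF par mu order.refl]]], goal_cases)
    case (2 s1)
    then have s1: "rreg s1 ''mu'' = mu" "nreg s1 ''sz'' \<le> T"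
      "if 0 < nreg s1 ''ok'' then good mu (narr s1 ''D'' ` {..<nreg s1 ''sz''}) else cert mu"
      "rreg s1 ''lambda'' = rreg s ''lambda''" "rreg s1 ''mus'' = rreg s ''mus''"
      "nreg s1 ''size'' = nreg s ''size''" "narr s1 ''C'' = narr s ''C''"
      by (auto simp: unchanged_def greedy_vars)
    show ?case
    proof (cases "0 < nreg s1 ''ok''")
      case False
      with s1 show ?thesis by (simp add: probe_post_def)
    next
      case True
      have "runs (copy_centers ;; NSet ''size'' (NReg ''sz'') ;; RSet ''mus'' (RReg ''mu'')) s1
          (T * 3 + 4) (probe_post mu s)"
      proof (rule runs_Seq[where b = 2], rule runs_mono[OF runs_unchanged[OF runs_copy_centers] order.refl])
        fix s2
        assume s2: "(\<forall>e<nreg s1 ''sz''. narr s2 ''C'' e = narr s1 ''D'' e) \<and> unchanged copy_centers s1 s2"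
        then have "narr s2 ''C'' ` {..<nreg s1 ''sz''} = narr s1 ''D'' ` {..<nreg s1 ''sz''}"
          by (intro image_cong) auto
        with s1 s2 True show "runs (NSet ''size'' (NReg ''sz'') ;; RSet ''mus'' (RReg ''mu'')) s2 2 (probe_post mu s)"
          by (simp add: probe_post_def unchanged_def copy_centers_def)
      qed (use s1 in simp)
      with True show ?thesis by (simp add: add.commute)
    qed
  qed simp
next
  \<comment> \<open>\<open>n <= m\<close> and \<open>m >= 6\<close> absorb the cost terms that lack
    a factor \<open>m\<close>.\<close>
  have m: "6 \<le> m" "n \<le> m" using n_ge_6 n_le_m by auto
  define X where "X = T * m"
  have "T * 6 \<le> X" unfolding X_def using m by (intro mult_le_mono2) simp
  moreover have "T * (m * 19 + 13) = 19 * X + 13 * T" "50 * m * (T + 1) = 50 * X + 50 * m"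
    by (simp_all add: X_def algebra_simps)
  ultimately show "n * 3 + T * (m * 19 + 13) + 6 + (T * 3 + 5) \<le> 50 * m * (T + 1)"
    using m by linarith
qed

end

section \<open>Merge sort\<close>

text \<open>For \<open>m >= 1\<close> this is the binary logarithm rounded up.\<close>

definition clog :: "nat \<Rightarrow> nat" where
  "clog m = (LEAST p. m \<le> 2 ^ p)"

lemma clog_ge: "m \<le> 2 ^ clog m"
  unfolding clog_def by (rule LeastI[of _ m]) (simp add: less_imp_le)

lemma clog_le: "m \<le> 2 ^ p \<Longrightarrow> clog m \<le> p"
  unfolding clog_def by (rule Least_le)

lemma clog_less:
  assumes "1 \<le> m" shows "2 ^ clog m < 2 * m"
proof (cases "clog m")
  case 0 with assms show ?thesis by simp
next
  case (Suc p)
  then have "\<not> m \<le> 2 ^ p" using clog_le[of m p] by auto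
  with Suc show ?thesis by simp
qed

\<comment> \<open>The costs are padded with zeros to a power of two, so that all blocks are full. Zeros are skipped
  by the binary search.\<close>
definition set_pad :: com where
  "set_pad = NSet ''M'' (NConst 1) ;;
     While (NLess (NReg ''M'') (NReg ''m'')) (NSet ''M'' (NAdd (NReg ''M'') (NReg ''M'')))"

definition load_costs :: com where
  "load_costs = For ''e'' ''m'' (RStore ''S'' (NReg ''e'') (RArr ''cost'' (NReg ''e'')))"

text \<open>One step writes one output entry, first opening the next block if the current one,
  ending at \<open>hi\<close>, is full. Thus blocks need no inner loop, and a pass is a single
  \<open>For\<close> of linear cost.\<close>

definition merge_step :: com where
  "merge_step =
     Cond (NLess (NReg ''o'') (NReg ''hi'')) Skip
       (NSet ''i'' (NReg ''o'') ;; NSet ''mid'' (NAdd (NReg ''o'') (NReg ''w'')) ;;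
        NSet ''q'' (NReg ''mid'') ;; NSet ''hi'' (NAdd (NReg ''mid'') (NReg ''w''))) ;;
     Cond (TAnd (NLess (NReg ''i'') (NReg ''mid''))
            (TNot (TAnd (NLess (NReg ''q'') (NReg ''hi''))
                        (RLess (RArr ''S'' (NReg ''q'')) (RArr ''S'' (NReg ''i''))))))
       (RStore ''B'' (NReg ''o'') (RArr ''S'' (NReg ''i'')) ;; NSet ''i'' (NAdd (NReg ''i'') (NConst 1)))
       (RStore ''B'' (NReg ''o'') (RArr ''S'' (NReg ''q'')) ;; NSet ''q'' (NAdd (NReg ''q'') (NConst 1)))"

definition copy_back :: com where
  "copy_back = For ''e'' ''M'' (RStore ''S'' (NReg ''e'') (RArr ''B'' (NReg ''e'')))"

text \<open>Starting with \<open>hi = 0\<close> makes the first step open a block.\<close>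

definition merge_pass :: com where
  "merge_pass = NSet ''hi'' (NConst 0) ;; For ''o'' ''M'' merge_step ;; copy_back ;;
     NSet ''w'' (NAdd (NReg ''w'') (NReg ''w''))"

definition sort_costs :: com where
  "sort_costs = set_pad ;; load_costs ;; NSet ''w'' (NConst 1) ;;
     While (NLess (NReg ''w'') (NReg ''M'')) merge_pass"

lemma merge_step_vars:
  "nregs merge_step = {''i'', ''mid'', ''q'', ''hi''}" "rregs merge_step = {}"
  "narrs merge_step = {}" "rarrs merge_step = {''B''}"
  by (auto simp: merge_step_def)

lemma sort_costs_vars:
  "nregs sort_costs = {''M'', ''e'', ''w'', ''o'', ''i'', ''mid'', ''q'', ''hi''}"
  "rregs sort_costs = {}" "narrs sort_costs = {}" "rarrs sort_costs = {''S'', ''B''}"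
  by (auto simp: sort_costs_def set_pad_def load_costs_def merge_pass_def merge_step_vars copy_back_def)

section \<open>Correctness of merging\<close>

definition sorted_blocks :: "(nat \<Rightarrow> real) \<Rightarrow> nat \<Rightarrow> nat \<Rightarrow> bool" where
  "sorted_blocks f w M \<longleftrightarrow> (\<forall>c. c * w + w \<le> M \<longrightarrow> mono_on {c * w..<c * w + w} f)"

definition merged :: "(nat \<Rightarrow> real) \<Rightarrow> (nat \<Rightarrow> real) \<Rightarrow> nat \<Rightarrow> nat \<Rightarrow> bool" where
  "merged f g w lo \<longleftrightarrow> sorted_blocks g (2 * w) lo \<and> f ` {..<lo} \<subseteq> g ` {..<lo}"

\<comment> \<open>The halves of the block of \<open>f\<close> at \<open>lo\<close> are consumed up to \<open>i\<close> and \<open>q\<close> and merged into \<open>g\<close> up to \<open>r\<close>.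
  Only the inclusion of the value sets matters, not multiplicities.\<close>
definition merging :: "(nat \<Rightarrow> real) \<Rightarrow> (nat \<Rightarrow> real) \<Rightarrow> nat \<Rightarrow> nat \<Rightarrow> nat \<Rightarrow> nat \<Rightarrow> nat \<Rightarrow> bool" where
  "merging f g w lo r i q \<longleftrightarrow> lo \<le> i \<and> i \<le> lo + w \<and> lo + w \<le> q \<and> q \<le> lo + w + w \<and> i + q = r + (lo + w) \<and>
     mono_on {lo..<r} g \<and>
     (\<forall>x\<in>{lo..<r}. \<forall>y\<in>{i..<lo + w} \<union> {q..<lo + w + w}. g x \<le> f y) \<and>
     f ` ({lo..<i} \<union> {lo + w..<q}) \<subseteq> g ` {lo..<r}"

lemma merging_start: "merging f g w lo lo lo (lo + w)"
  by (simp add: merging_def)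

lemma merging_append:
  assumes m: "merging f g w lo r i q"
    and ge: "\<And>x. x \<in> {lo..<r} \<Longrightarrow> g x \<le> v"
  shows "mono_on {lo..<Suc r} (g(r := v))"
    and "g ` {lo..<r} \<subseteq> (g(r := v)) ` {lo..<Suc r}"
    and "v \<in> (g(r := v)) ` {lo..<Suc r}"
proof -
  have r: "lo \<le> r" using m by (auto simp: merging_def)
  show "mono_on {lo..<Suc r} (g(r := v))"
    using m ge by (auto simp: merging_def mono_on_def less_Suc_eq)
  show "g ` {lo..<r} \<subseteq> (g(r := v)) ` {lo..<Suc r}"
  proof
    fix y assume "y \<in> g ` {lo..<r}"
    then obtain x where "x \<in> {lo..<r}" "y = g x" by auto
    then show "y \<in> (g(r := v)) ` {lo..<Suc r}" by (intro image_eqI[of _ _ x]) auto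
  qed
  show "v \<in> (g(r := v)) ` {lo..<Suc r}" using r by (intro image_eqI[of _ _ r]) auto
qed

text \<open>As both halves are sorted and \<open>f i\<close> does not exceed the other head, it is
  the least unconsumed value. By the invariant it is at least every value written, so appending it
  keeps the output sorted.\<close>

lemma merging_left:
  assumes m: "merging f g w lo r i q" and i: "i < lo + w"
    and le: "q < lo + w + w \<Longrightarrow> f i \<le> f q"
    and f: "mono_on {lo..<lo + w} f" "mono_on {lo + w..<lo + w + w} f"
  shows "merging f (g(r := f i)) w lo (Suc r) (Suc i) q"
proof -
  have ge: "g x \<le> f i" if "x \<in> {lo..<r}" for x using m that i by (auto simp: merging_def)
  note app = merging_append[OF m ge]
  have b: "lo \<le> i" "lo + w \<le> q" using m by (auto simp: merging_def)
  have min: "f i \<le> f y" if "y \<in> {i..<lo + w} \<union> {q..<lo + w + w}" for y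
  proof (cases "y < lo + w")
    case True with that f(1) i b show ?thesis by (auto simp: mono_on_def)
  next
    case False
    with that b have y: "q \<le> y" "y < lo + w + w" by auto
    with f(2) b have "f q \<le> f y" by (auto simp: mono_on_def)
    with le y show ?thesis by simp
  qed
  have "{lo..<Suc i} = insert i {lo..<i}" using b by auto
  then have "f ` ({lo..<Suc i} \<union> {lo + w..<q}) \<subseteq> insert (f i) (g ` {lo..<r})"
    using m by (auto simp: merging_def)
  then have "f ` ({lo..<Suc i} \<union> {lo + w..<q}) \<subseteq> (g(r := f i)) ` {lo..<Suc r}"
    using insert_subsetI[OF app(3,2)] by (rule order_trans)
  moreover have "\<forall>x\<in>{lo..<Suc r}. \<forall>y\<in>{Suc i..<lo + w} \<union> {q..<lo + w + w}. (g(r := f i)) x \<le> f y"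
    using m min by (auto simp: merging_def less_Suc_eq)
  ultimately show ?thesis using m i app(1) by (simp add: merging_def)
qed

lemma merging_right:
  assumes m: "merging f g w lo r i q" and q: "q < lo + w + w"
    and le: "i < lo + w \<Longrightarrow> f q \<le> f i"
    and f: "mono_on {lo..<lo + w} f" "mono_on {lo + w..<lo + w + w} f"
  shows "merging f (g(r := f q)) w lo (Suc r) i (Suc q)"
proof -
  have ge: "g x \<le> f q" if "x \<in> {lo..<r}" for x using m that q by (auto simp: merging_def)
  note app = merging_append[OF m ge]
  have b: "lo \<le> i" "lo + w \<le> q" using m by (auto simp: merging_def)
  have min: "f q \<le> f y" if "y \<in> {i..<lo + w} \<union> {q..<lo + w + w}" for y
  proof (cases "y < lo + w")
    case False with that f(2) q b show ?thesis by (auto simp: mono_on_def)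
  next
    case True
    with that b have y: "i \<le> y" "y < lo + w" by auto
    with f(1) b have "f i \<le> f y" by (auto simp: mono_on_def)
    with le y show ?thesis by simp
  qed
  have "{lo + w..<Suc q} = insert q {lo + w..<q}" using b by auto
  then have "f ` ({lo..<i} \<union> {lo + w..<Suc q}) \<subseteq> insert (f q) (g ` {lo..<r})"
    using m by (auto simp: merging_def)
  then have "f ` ({lo..<i} \<union> {lo + w..<Suc q}) \<subseteq> (g(r := f q)) ` {lo..<Suc r}"
    using insert_subsetI[OF app(3,2)] by (rule order_trans)
  moreover have "\<forall>x\<in>{lo..<Suc r}. \<forall>y\<in>{i..<lo + w} \<union> {Suc q..<lo + w + w}. (g(r := f q)) x \<le> f y"
    using m min by (auto simp: merging_def less_Suc_eq)
  ultimately show ?thesis using m q app(1) by (simp add: merging_def)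
qed

lemma merged_upd:
  assumes "merged f g w lo" "lo \<le> r"
  shows "merged f (g(r := v)) w lo"
proof -
  have "(g(r := v)) ` {..<lo} = g ` {..<lo}" using assms(2) by (intro image_cong) auto
  moreover have "sorted_blocks (g(r := v)) (2 * w) lo"
    using assms unfolding merged_def sorted_blocks_def mono_on_def by fastforce
  ultimately show ?thesis using assms by (simp add: merged_def)
qed

text \<open>At a full block the count \<open>i + q = r + (lo + w)\<close> forces both halves to be
  consumed, so the inclusion of values covers the whole block.\<close>

lemma merged_block:
  assumes d: "merged f g w (c * (2 * w))"
    and m: "merging f g w (c * (2 * w)) (c * (2 * w) + w + w) i q"
  shows "merged f g w (Suc c * (2 * w))"
proof -
  let ?lo = "c * (2 * w)"
  have hi: "Suc c * (2 * w) = ?lo + w + w" by simp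
  have iq: "i = ?lo + w" "q = ?lo + w + w" using m by (auto simp: merging_def)
  have "sorted_blocks g (2 * w) (Suc c * (2 * w))"
    unfolding sorted_blocks_def
  proof (intro allI impI)
    fix c' assume "c' * (2 * w) + 2 * w \<le> Suc c * (2 * w)"
    then have "Suc c' * (2 * w) \<le> Suc c * (2 * w)" by simp
    then have "w = 0 \<or> c' \<le> c" unfolding mult_le_cancel2 by auto
    then consider "w = 0" | "c' = c" | "c' < c" by linarith
    then show "mono_on {c' * (2 * w)..<c' * (2 * w) + 2 * w} g"
    proof cases
      case 1 then show ?thesis by (simp add: mono_on_def)
    next
      case 2 with m show ?thesis by (simp add: merging_def mult_2 add.assoc)
    next
      case 3
      then have "Suc c' * (2 * w) \<le> c * (2 * w)" by (intro mult_le_mono1) simp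
      then show ?thesis using d by (simp add: merged_def sorted_blocks_def)
    qed
  qed
  moreover have "f ` {..<?lo + w + w} \<subseteq> g ` {..<?lo + w + w}"
  proof -
    have "{..<?lo + w + w} = {..<?lo} \<union> ({?lo..<?lo + w} \<union> {?lo + w..<?lo + w + w})" by auto
    then have "f ` {..<?lo + w + w} \<subseteq> g ` {..<?lo} \<union> g ` {?lo..<?lo + w + w}"
      using d m unfolding merged_def merging_def iq by blast
    also have "\<dots> \<subseteq> g ` {..<?lo + w + w}" by auto
    finally show ?thesis .
  qed
  ultimately show ?thesis unfolding merged_def hi by simp
qed

text \<open>Either no block is open, and \<open>hi <= r\<close> makes the next step open one, or
  \<open>r\<close> lies in an open block. A just completed block still falls under the second case;
  \<open>merge_inv_boundary\<close> converts it to the first.\<close>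

definition merge_inv :: "(nat \<Rightarrow> real) \<Rightarrow> nat \<Rightarrow> nat \<Rightarrow> nat \<Rightarrow> store \<Rightarrow> bool" where
  "merge_inv f w M r s \<longleftrightarrow> (\<exists>c. let lo = c * (2 * w) in merged f (rarr s ''B'') w lo \<and>
     (lo = r \<and> nreg s ''hi'' \<le> r \<or>
      lo \<le> r \<and> r \<le> nreg s ''hi'' \<and> nreg s ''hi'' = lo + w + w \<and> nreg s ''hi'' \<le> M \<and>
      nreg s ''mid'' = lo + w \<and> merging f (rarr s ''B'') w lo r (nreg s ''i'') (nreg s ''q'')))"

lemma merge_inv_boundary:
  assumes "merge_inv f w M r s" "nreg s ''hi'' \<le> r"
  shows "\<exists>c. c * (2 * w) = r \<and> merged f (rarr s ''B'') w r"
proof -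
  obtain c where c: "merged f (rarr s ''B'') w (c * (2 * w))"
    "c * (2 * w) = r \<or> r \<le> nreg s ''hi'' \<and> nreg s ''hi'' = c * (2 * w) + w + w \<and>
      merging f (rarr s ''B'') w (c * (2 * w)) r (nreg s ''i'') (nreg s ''q'')"
    using assms(1) by (auto simp: merge_inv_def Let_def)
  show ?thesis
  proof (cases "c * (2 * w) = r")
    case True with c show ?thesis by auto
  next
    case False
    with c assms(2) have r: "r = c * (2 * w) + w + w"
      "merging f (rarr s ''B'') w (c * (2 * w)) (c * (2 * w) + w + w) (nreg s ''i'') (nreg s ''q'')"
      by auto
    from merged_block[OF c(1) r(2)] r(1) show ?thesis by (intro exI[of _ "Suc c"]) auto
  qed
qed

lemma runs_merge_step:
  assumes inv: "merge_inv f w M r s" and r: "r < M" "nreg s ''o'' = r" and w: "nreg s ''w'' = w" "0 < w"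
    and S: "rarr s ''S'' = f" and f: "sorted_blocks f w M" and dvd: "2 * w dvd M"
  shows "runs merge_step s 8 (\<lambda>s'. merge_inv f w M (Suc r) (s'\<lparr>nreg := (nreg s')(''o'' := Suc r)\<rparr>))"
proof -
  let ?body = "Cond (TAnd (NLess (NReg ''i'') (NReg ''mid''))
            (TNot (TAnd (NLess (NReg ''q'') (NReg ''hi''))
                        (RLess (RArr ''S'' (NReg ''q'')) (RArr ''S'' (NReg ''i''))))))
       (RStore ''B'' (NReg ''o'') (RArr ''S'' (NReg ''i'')) ;; NSet ''i'' (NAdd (NReg ''i'') (NConst 1)))
       (RStore ''B'' (NReg ''o'') (RArr ''S'' (NReg ''q'')) ;; NSet ''q'' (NAdd (NReg ''q'') (NConst 1)))"
  let ?R = "\<lambda>s'. merge_inv f w M (Suc r) (s'\<lparr>nreg := (nreg s')(''o'' := Suc r)\<rparr>)"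
  have body: "runs ?body u 3 ?R"
    if u: "merged f (rarr u ''B'') w lo" "lo = c * (2 * w)" "lo \<le> r" "r < lo + w + w" "lo + w + w \<le> M"
      "nreg u ''hi'' = lo + w + w" "nreg u ''mid'' = lo + w" "nreg u ''o'' = r" "rarr u ''S'' = f"
      "merging f (rarr u ''B'') w lo r (nreg u ''i'') (nreg u ''q'')" for u lo c
  proof -
    let ?i = "nreg u ''i''" and ?q = "nreg u ''q''" and ?B = "rarr u ''B''"
    \<comment> \<open>The halves of block \<open>c\<close> of width \<open>2 w\<close> are the
      blocks \<open>2 c\<close> and \<open>2 c + 1\<close> of width \<open>w\<close>.\<close>
    have "2 * c * w = lo" "(2 * c + 1) * w = lo + w" using u(2) by (auto simp: algebra_simps)
    with f[unfolded sorted_blocks_def, rule_format, of "2 * c"]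
      f[unfolded sorted_blocks_def, rule_format, of "2 * c + 1"] u(5)
    have halves: "mono_on {lo..<lo + w} f" "mono_on {lo + w..<lo + w + w} f"
      by (simp_all add: add.commute)
    have b: "?i \<le> lo + w" "?q \<le> lo + w + w" "?i + ?q = r + (lo + w)" using u(10) by (auto simp: merging_def)
    have inv': "merge_inv f w M (Suc r) u'" if "rarr u' ''B'' = ?B(r := v)" "nreg u' ''hi'' = lo + w + w"
      "nreg u' ''mid'' = lo + w" "merging f (?B(r := v)) w lo (Suc r) (nreg u' ''i'') (nreg u' ''q'')" for u' v
      unfolding merge_inv_def using merged_upd[OF u(1,3), of v] u that by (auto simp: Let_def intro!: exI[of _ c])
    show ?thesis
    proof (cases "?i < lo + w \<and> \<not> (?q < lo + w + w \<and> f ?q < f ?i)")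
      case True
      then have "merging f (?B(r := f ?i)) w lo (Suc r) (Suc ?i) ?q"
        by (intro merging_left[OF u(10) _ _ halves]) auto
      then have "merge_inv f w M (Suc r) (u\<lparr>rarr := (rarr u)(''B'' := ?B(r := f ?i)),
          nreg := (nreg u)(''i'' := Suc ?i, ''o'' := Suc r)\<rparr>)"
        by (intro inv'[where v = "f ?i"]) (use u(6-9) in simp_all)
      with True u(6-9) show ?thesis by simp
    next
      case False
      then have "merging f (?B(r := f ?q)) w lo (Suc r) ?i (Suc ?q)"
        using b u(4) by (intro merging_right[OF u(10) _ _ halves]) auto
      then have "merge_inv f w M (Suc r) (u\<lparr>rarr := (rarr u)(''B'' := ?B(r := f ?q)),
          nreg := (nreg u)(''q'' := Suc ?q, ''o'' := Suc r)\<rparr>)"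
        by (intro inv'[where v = "f ?q"]) (use u(6-9) in simp_all)
      with False u(6-9) show ?thesis by auto
    qed
  qed
  show ?thesis
  proof (cases "r < nreg s ''hi''")
    case True
    with inv obtain c where "merged f (rarr s ''B'') w (c * (2 * w))" "c * (2 * w) \<le> r"
      "nreg s ''hi'' = c * (2 * w) + w + w" "nreg s ''hi'' \<le> M" "nreg s ''mid'' = c * (2 * w) + w"
      "merging f (rarr s ''B'') w (c * (2 * w)) r (nreg s ''i'') (nreg s ''q'')"
      by (auto simp: merge_inv_def Let_def)
    with True r S have "runs ?body s 3 ?R" by (intro body[of s "c * (2 * w)" c]) auto
    then have "runs ?body s 6 ?R" by (rule runs_mono) auto
    with True r show ?thesis by (simp only: merge_step_def runs_Seq_Cond runs_Seq_Skip) simp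
  next
    case False
    then obtain c where c: "c * (2 * w) = r" "merged f (rarr s ''B'') w r"
      using merge_inv_boundary[OF inv] by auto
    \<comment> \<open>Both \<open>r\<close> and \<open>M\<close> are multiples of
      \<open>2 w\<close>, so \<open>r < M\<close> leaves room for a whole block.\<close>
    have "r + w + w \<le> M"
    proof -
      obtain d where d: "M = 2 * w * d" using dvd by auto
      with c(1) r have "c * (2 * w) < d * (2 * w)" by (simp add: mult.commute)
      then have "c < d" unfolding mult_less_cancel2 by simp
      then have "Suc c * (2 * w) \<le> d * (2 * w)" by (intro mult_le_mono1) simp
      with c d show ?thesis by (simp add: algebra_simps)
    qed
    let ?u = "s\<lparr>nreg := (nreg s)(''i'' := r, ''mid'' := r + w, ''q'' := r + w, ''hi'' := r + w + w)\<rparr>"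
    have "runs ?body ?u 3 ?R"
      using c r w S \<open>r + w + w \<le> M\<close> merging_start[of f "rarr s ''B''" w r]
      by (intro body[of ?u r c]) auto
    with False r w show ?thesis
      by (simp only: merge_step_def runs_Seq_Cond runs_Seq_assoc runs_Seq_NSet) simp
  qed
qed

lemma runs_merge_pass:
  assumes M: "nreg s ''M'' = M" and w: "nreg s ''w'' = w" "0 < w" "2 * w dvd M"
    and f: "sorted_blocks (rarr s ''S'') w M"
  shows "runs merge_pass s (M * 13 + 6) (\<lambda>s'. nreg s' ''w'' = 2 * w \<and>
    sorted_blocks (rarr s' ''S'') (2 * w) M \<and> rarr s ''S'' ` {..<M} \<subseteq> rarr s' ''S'' ` {..<M})"
    (is "runs _ _ _ ?R")
proof -
  let ?f = "rarr s ''S''" and ?s1 = "s\<lparr>nreg := (nreg s)(''hi'' := 0)\<rparr>"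
  have "runs (For ''o'' ''M'' merge_step ;; copy_back ;; NSet ''w'' (NAdd (NReg ''w'') (NReg ''w''))) ?s1
    (5 + M * 13) ?R"
  proof (rule runs_Seq[where a = "M * 10 + 2" and b = "M * 3 + 3"],
      rule runs_For[where J = "merge_inv ?f w M" and M = M and B = 8], goal_cases)
    case 1
    show ?case
      unfolding merge_inv_def Let_def
      by (rule exI[of _ 0]) (use w in \<open>simp add: merged_def sorted_blocks_def\<close>)
  next
    case (6 r s')
    then show ?case using w f
      by (intro runs_merge_step) (auto simp: unchanged_def merge_step_vars)
  next
    case (7 s')
    have un: "nreg s' ''M'' = M" "nreg s' ''w'' = w"
      using 7 M w by (auto simp: unchanged_def merge_step_vars)
    have "nreg s' ''hi'' \<le> M" using 7(1) by (auto simp: merge_inv_def Let_def)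
    from merge_inv_boundary[OF 7(1) this] have merged: "merged ?f (rarr s' ''B'') w M" by auto
    show ?case
    proof (rule runs_Seq[where a = "M * 3 + 2" and b = 1])
      show "runs copy_back s' (M * 3 + 2) (\<lambda>s'. runs (NSet ''w'' (NAdd (NReg ''w'') (NReg ''w''))) s' 1 ?R)"
        unfolding copy_back_def
      proof (rule runs_For[where M = M and B = 1 and
            J = "\<lambda>i u. \<forall>x<i. rarr u ''S'' x = rarr s' ''B'' x"], goal_cases)
        case (7 u)
        then have "rarr u ''S'' ` {..<M} = rarr s' ''B'' ` {..<M}" by (intro image_cong) auto
        moreover have "sorted_blocks (rarr u ''S'') (2 * w) M"
          using merged 7(1) unfolding merged_def sorted_blocks_def mono_on_def by auto
        moreover have "nreg u ''w'' = w" using 7 un by (simp add: unchanged_def)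
        ultimately show ?case using merged by (auto simp: merged_def)
      qed (use un in \<open>auto simp: unchanged_def less_Suc_eq\<close>)
    qed simp
  qed (use M in \<open>auto simp: merge_step_vars\<close>)
  then show ?thesis by (simp add: merge_pass_def)
qed

text \<open>There are \<open>clog m\<close> passes over fewer than \<open>2 m\<close> entries. An
  inclusion of the costs suffices: the search must separate all costs, and extra entries do no
  harm.\<close>

lemma runs_sort_costs:
  assumes m: "nreg s ''m'' = m" "1 \<le> m"
  shows "runs sort_costs s (60 * m * (clog m + 1)) (\<lambda>s'. nreg s' ''M'' = 2 ^ clog m \<and>
    mono_on {..<2 ^ clog m} (rarr s' ''S'') \<and> rarr s ''cost'' ` {..<m} \<subseteq> rarr s' ''S'' ` {..<2 ^ clog m})"
    (is "runs _ _ _ ?R")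
proof -
  let ?p = "clog m" and ?M = "2 ^ clog m :: nat"
  let ?loop = "While (NLess (NReg ''w'') (NReg ''M'')) merge_pass"
  have pad: "runs set_pad s (?p * 2 + 2) (\<lambda>s'. nreg s' ''M'' = ?M)"
  proof -
    have "runs (While (NLess (NReg ''M'') (NReg ''m'')) (NSet ''M'' (NAdd (NReg ''M'') (NReg ''M''))))
      (s\<lparr>nreg := (nreg s)(''M'' := 1)\<rparr>) (?p * 2 + 1) (\<lambda>s'. nreg s' ''M'' = ?M)"
    proof (rule runs_While[where B = 1 and i = ?p and I = "\<lambda>i s'. i \<le> ?p \<and> nreg s' ''M'' = 2 ^ (?p - i)"],
        goal_cases)
      case (2 i s')
      then have i: "nreg s' ''m'' = m" using m by (simp add: unchanged_def)
      with 2 have "2 ^ (?p - i) < m" by simp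
      also have "m \<le> 2 ^ ?p" by (rule clog_ge)
      finally have "0 < i" by (cases i) auto
      moreover have "2 ^ (?p - (i - 1)) = 2 ^ (?p - i) + (2 ^ (?p - i) :: nat)"
      proof -
        have "?p - (i - 1) = Suc (?p - i)" using 2(1) \<open>0 < i\<close> by linarith
        then show ?thesis by simp
      qed
      ultimately show ?case using 2 by auto
    next
      case (3 i s')
      \<comment> \<open>\<open>clog m\<close> is the least such exponent, so the loop cannot stop
        before \<open>M\<close> is \<open>2 ^ clog m\<close>.\<close>
      then have "m \<le> 2 ^ (?p - i)" using m by (simp add: unchanged_def)
      from clog_le[OF this] 3 have "i = 0 \<or> ?p = 0" by auto
      with 3 show ?case by auto
    qed auto
    then show ?thesis by (simp add: set_pad_def)
  qed
  have load: "runs load_costs s1 (m * 3 + 2) (\<lambda>s'. \<forall>e<m. rarr s' ''S'' e = rarr s1 ''cost'' e)"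
    if "nreg s1 ''m'' = m" for s1
    unfolding load_costs_def
    by (rule runs_For[where M = m and B = 1 and J = "\<lambda>i s'. \<forall>e<i. rarr s' ''S'' e = rarr s1 ''cost'' e"])
      (use that in \<open>auto simp: unchanged_def less_Suc_eq\<close>)
  have loop: "runs ?loop s3 (?p * (?M * 13 + 7) + 1) ?R"
    if s3: "nreg s3 ''M'' = ?M" "nreg s3 ''w'' = 1" "rarr s ''cost'' ` {..<m} \<subseteq> rarr s3 ''S'' ` {..<?M}" for s3
  proof (rule runs_While[where B = "?M * 13 + 6" and i = ?p and
        I = "\<lambda>i s'. i \<le> ?p \<and> nreg s' ''w'' = 2 ^ (?p - i) \<and> sorted_blocks (rarr s' ''S'') (2 ^ (?p - i)) ?M \<and>
          rarr s ''cost'' ` {..<m} \<subseteq> rarr s' ''S'' ` {..<?M}"], goal_cases)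
    case 1
    with s3 show ?case by (auto simp: sorted_blocks_def mono_on_def)
  next
    case (2 i s')
    have M: "nreg s' ''M'' = ?M"
      using 2 s3 by (simp add: unchanged_def merge_pass_def merge_step_vars copy_back_def)
    with 2 have "0 < i" by (cases i) auto
    have eq: "?p - (i - 1) = Suc (?p - i)" using 2(1) \<open>0 < i\<close> by linarith
    have dvd: "2 * 2 ^ (?p - i) dvd ?M"
      unfolding power_Suc[symmetric] using \<open>0 < i\<close> 2(1) by (intro le_imp_power_dvd) linarith
    from runs_merge_pass[OF M, of "2 ^ (?p - i)"] 2(1) dvd
    have "runs merge_pass s' (?M * 13 + 6) (\<lambda>u. nreg u ''w'' = 2 * 2 ^ (?p - i) \<and>
        sorted_blocks (rarr u ''S'') (2 * 2 ^ (?p - i)) ?M \<and> rarr s' ''S'' ` {..<?M} \<subseteq> rarr u ''S'' ` {..<?M})"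
      by simp
    then have "runs merge_pass s' (?M * 13 + 6) (\<lambda>u. i - 1 \<le> ?p \<and> nreg u ''w'' = 2 ^ (?p - (i - 1)) \<and>
        sorted_blocks (rarr u ''S'') (2 ^ (?p - (i - 1))) ?M \<and>
        rarr s ''cost'' ` {..<m} \<subseteq> rarr u ''S'' ` {..<?M})"
      unfolding eq power_Suc using 2(1) by (elim runs_mono) (blast intro: le_trans[OF diff_le_self])+
    with \<open>0 < i\<close> show ?case by blast
  next
    case (3 i s')
    have "nreg s' ''M'' = ?M"
      using 3 s3 by (simp add: unchanged_def merge_pass_def merge_step_vars copy_back_def)
    moreover from this 3 have "?M \<le> 2 ^ (?p - i)" by simp
    then have "?p \<le> ?p - i" by simp
    then have "?p - i = ?p" by simp
    with 3 have "sorted_blocks (rarr s' ''S'') ?M ?M" by auto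
    then have "mono_on {..<?M} (rarr s' ''S'')"
      unfolding sorted_blocks_def by (auto dest!: spec[of _ 0] simp: atLeast0LessThan)
    ultimately show ?case using 3 by simp
  qed auto
  have "runs sort_costs s (?p * 2 + 2 + (m * 3 + 2 + (1 + (?p * (?M * 13 + 7) + 1)))) ?R"
    unfolding sort_costs_def
  proof (rule runs_Seq[OF runs_mono[OF runs_unchanged[OF pad] order.refl] order.refl])
    fix s1 assume 1: "nreg s1 ''M'' = ?M \<and> unchanged set_pad s s1"
    then have m1: "nreg s1 ''m'' = m" using m by (simp add: unchanged_def set_pad_def)
    show "runs (load_costs ;; NSet ''w'' (NConst 1) ;; ?loop) s1
        (m * 3 + 2 + (1 + (?p * (?M * 13 + 7) + 1))) ?R"
    proof (rule runs_Seq[OF runs_mono[OF runs_unchanged[OF load[OF m1]] order.refl] order.refl])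
      fix s2 assume 2: "(\<forall>e<m. rarr s2 ''S'' e = rarr s1 ''cost'' e) \<and> unchanged load_costs s1 s2"
      let ?s3 = "s2\<lparr>nreg := (nreg s2)(''w'' := 1)\<rparr>"
      have "rarr s1 ''cost'' = rarr s ''cost''" using 1 by (simp add: unchanged_def set_pad_def)
      with 2 have "rarr s ''cost'' ` {..<m} = rarr s2 ''S'' ` {..<m}" by (intro image_cong) auto
      also have "\<dots> \<subseteq> rarr s2 ''S'' ` {..<?M}" using clog_ge[of m] by (intro image_mono) auto
      finally have "runs ?loop ?s3 (?p * (?M * 13 + 7) + 1) ?R"
        using 1 2 by (intro loop) (auto simp: unchanged_def load_costs_def)
      then show "runs (NSet ''w'' (NConst 1) ;; ?loop) s2 (1 + (?p * (?M * 13 + 7) + 1)) ?R"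
        by simp
    qed
  qed
  moreover have "?p * 2 + 2 + (m * 3 + 2 + (1 + (?p * (?M * 13 + 7) + 1))) \<le> 60 * m * (?p + 1)"
  proof -
    have "?p * (?M * 13 + 9) \<le> ?p * (2 * m * 13 + 9 * m)"
      using clog_less[OF m(2)] m(2) by (intro mult_le_mono2 add_mono) auto
    also have "\<dots> = 35 * (m * ?p)" by simp
    finally show ?thesis using m(2) by (simp add: algebra_simps)
  qed
  ultimately show ?thesis by (rule runs_mono) auto
qed

section \<open>Search for the critical value\<close>

abbreviation nat_real :: "nat \<Rightarrow> rexp" where "nat_real c \<equiv> RNat (NConst c)"

text \<open>The initial \<open>mu = 0\<close> makes the first probe test an infinite lambda.\<close>

definition set_params :: com where
  "set_params =
     RSet ''al'' (RSub (nat_real 1) (RDiv (RMul (nat_real 2) (RNat (NReg ''k''))) (RNat (NReg ''n'')))) ;;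
     RSet ''cap'' (RDiv (nat_real 1) (RAdd (RMul (nat_real 2) (RNat (NReg ''k''))) (nat_real 1))) ;;
     RSet ''th'' (RSub (nat_real 1) (RMul (RDiv
        (RMul (RMul (nat_real 2) (RNat (NReg ''k''))) (RAdd (RMul (nat_real 2) (RNat (NReg ''k''))) (nat_real 1)))
        (RMul (RNat (NReg ''n'')) (RNat (NReg ''n'')))) (RReg ''al''))) ;;
     RSet ''mu'' (nat_real 0)"

text \<open>A cost 0 has no reciprocal; it counts as failing, since 0 is always a lower
  bound.\<close>

definition bisect_costs_step :: com where
  "bisect_costs_step =
     NSet ''c'' (NHalf (NAdd (NReg ''lo'') (NReg ''up''))) ;;
     Cond (RLess (nat_real 0) (RArr ''S'' (NReg ''c'')))
       (RSet ''mu'' (RDiv (nat_real 1) (RArr ''S'' (NReg ''c''))) ;;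
        probe ;;
        Cond (NLess (NConst 0) (NReg ''ok''))
          (NSet ''up'' (NReg ''c''))
          (NSet ''lo'' (NAdd (NReg ''c'') (NConst 1))))
       (NSet ''lo'' (NAdd (NReg ''c'') (NConst 1)))"

definition bisect_costs :: com where
  "bisect_costs =
     NSet ''lo'' (NConst 0) ;; NSet ''up'' (NReg ''M'') ;;
     While (NLess (NReg ''lo'') (NReg ''up'')) bisect_costs_step"

text \<open>The probe is at the midpoint of \<open>lambda\<close> and \<open>1 / mus\<close>.
  Halving \<open>R\<close> limits the number of rounds independently of the costs.\<close>

definition bisect_gap_step :: com where
  "bisect_gap_step =
     RSet ''mu'' (RDiv (nat_real 2) (RAdd (RReg ''lambda'') (RDiv (nat_real 1) (RReg ''mus'')))) ;;
     probe ;;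
     RSet ''R'' (RDiv (RReg ''R'') (nat_real 2))"

abbreviation n_cubed :: rexp where
  "n_cubed \<equiv> RMul (RMul (RNat (NReg ''n'')) (RNat (NReg ''n''))) (RNat (NReg ''n''))"

text \<open>After a success at \<open>L n^3\<close> the gap is below
  \<open>L n^3 = L n^5 / n^2\<close>, which explains the start value \<open>n^5\<close>. After a
  failure the centers at hand already suffice, and \<open>R = 0\<close> skips the loop.\<close>

definition refine :: com where
  "refine =
     RSet ''mu'' (RDiv (nat_real 1) (RMul (RReg ''lambda'') n_cubed)) ;;
     probe ;;
     Cond (NLess (NConst 0) (NReg ''ok''))
       (RSet ''R'' (RMul (RMul n_cubed (RNat (NReg ''n''))) (RNat (NReg ''n''))))
       (RSet ''R'' (nat_real 0)) ;;
     While (RLess (nat_real 1) (RReg ''R'')) bisect_gap_step"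

definition search :: com where
  "search = sort_costs ;; bisect_costs ;; Cond (RLess (nat_real 0) (RReg ''lambda'')) refine Skip"

definition solve :: com where
  "solve =
     set_params ;;
     probe ;;
     Cond (NLess (NConst 0) (NReg ''ok''))
       search
       (NSet ''infinite'' (NConst 1) ;; NSet ''size'' (NConst 0))"

context greedy_instance
begin

section \<open>Correctness of the search\<close>

abbreviation center_set :: "store \<Rightarrow> nat set" where
  "center_set s \<equiv> narr s ''C'' ` {..<nreg s ''size''}"

text \<open>The ends of the search interval: a certified \<open>lambda\<close> and a succeeding
  \<open>1 / mus\<close>, read as infinite at \<open>mus = 0\<close>. No order between them is
  claimed, as success is not shown to be monotone in \<open>mu\<close>.\<close>

definition bracket :: "store \<Rightarrow> bool" where
  "bracket s \<longleftrightarrow> par s \<and> nreg s ''infinite'' = 0 \<and> 0 \<le> rreg s ''lambda'' \<and>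
     ennreal (rreg s ''lambda'') \<le> lp_opt G \<and> good (rreg s ''mus'') (center_set s)"

abbreviation "probe_time \<equiv> 50 * m * (T + 1)"

lemma runs_probe_bracket:
  assumes b: "bracket s" and mu: "rreg s ''mu'' = mu" "0 < mu"
  shows "runs probe s probe_time (\<lambda>s'. bracket s' \<and> unchanged probe s s' \<and>
    (if 0 < nreg s' ''ok'' then rreg s' ''mus'' = mu \<and> rreg s' ''lambda'' = rreg s ''lambda''
     else rreg s' ''lambda'' = 1 / mu \<and> rreg s' ''mus'' = rreg s ''mus'' \<and> center_set s' = center_set s))"
proof (rule runs_mono[OF runs_unchanged[OF runs_probe[OF _ mu(1)]]])
  fix s' assume s': "probe_post mu s s' \<and> unchanged probe s s'"
  have "par s'" by (rule par_unchanged[of s probe]) (use b s' in \<open>auto simp: bracket_def probe_vars\<close>)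
  moreover have "nreg s' ''infinite'' = 0"
    using b s' by (auto simp: bracket_def unchanged_def probe_vars)
  ultimately show "bracket s' \<and> unchanged probe s s' \<and>
    (if 0 < nreg s' ''ok'' then rreg s' ''mus'' = mu \<and> rreg s' ''lambda'' = rreg s ''lambda''
     else rreg s' ''lambda'' = 1 / mu \<and> rreg s' ''mus'' = rreg s ''mus'' \<and> center_set s' = center_set s)"
    using b s' mu by (auto simp: bracket_def probe_post_def cert_def split: if_splits)
qed (use b mu in \<open>auto simp: bracket_def\<close>)

text \<open>The product form of the upper condition avoids \<open>1 / mus\<close>, which would be 0
  instead of infinite at \<open>mus = 0\<close>.\<close>

definition cost_inv :: "(nat \<Rightarrow> real) \<Rightarrow> nat \<Rightarrow> nat \<Rightarrow> store \<Rightarrow> bool" where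
  "cost_inv f M i s \<longleftrightarrow> bracket s \<and> rarr s ''S'' = f \<and> nreg s ''lo'' \<le> nreg s ''up'' \<and> nreg s ''up'' \<le> M \<and>
     (\<forall>x<nreg s ''lo''. f x \<le> rreg s ''lambda'') \<and>
     (\<forall>x. nreg s ''up'' \<le> x \<longrightarrow> x < M \<longrightarrow> 1 \<le> rreg s ''mus'' * f x) \<and>
     nreg s ''up'' - nreg s ''lo'' < 2 ^ i"

lemma runs_bisect_costs_step:
  assumes inv: "cost_inv f M i s" and guard: "nreg s ''lo'' < nreg s ''up''" and f: "mono_on {..<M} f"
  shows "0 < i \<and> runs bisect_costs_step s (probe_time + 5) (cost_inv f M (i - 1))"
proof -
  let ?lo = "nreg s ''lo''" and ?up = "nreg s ''up''"
  let ?c = "(?lo + ?up) div 2"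
  have up: "?up \<le> M" and S: "rarr s ''S'' = f" and b: "bracket s"
    and low: "\<forall>x<?lo. f x \<le> rreg s ''lambda''"
    and high: "\<forall>x. ?up \<le> x \<longrightarrow> x < M \<longrightarrow> 1 \<le> rreg s ''mus'' * f x"
    and small: "?up - ?lo < 2 ^ i"
    using inv by (auto simp: cost_inv_def)
  have c: "?lo \<le> ?c" "?c < ?up" using guard by auto
  have "0 < i" using small guard by (cases i) auto
  then obtain i' where i': "i = Suc i'" by (cases i) auto
  \<comment> \<open>Removing the midpoint from either remaining part halves the strict length
    bound.\<close>
  have small': "?up - Suc ?c < 2 ^ i'" "?c - ?lo < 2 ^ i'" using small guard i' by auto
  have below: "f x \<le> f ?c" if "x \<le> ?c" for x
    using f that c up by (auto simp: mono_on_def)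
  have above: "f ?c \<le> f x" if "?c \<le> x" "x < M" for x
    using f that by (auto simp: mono_on_def)
  show ?thesis
  proof (cases "0 < f ?c")
    case False
    \<comment> \<open>By sortedness all entries up to a nonpositive one are nonpositive, hence at
      most \<open>lambda >= 0\<close>.\<close>
    have "\<forall>x<Suc ?c. f x \<le> rreg s ''lambda''"
      using below False b by (force simp: bracket_def less_Suc_eq_le)
    moreover have "bracket (s\<lparr>nreg := (nreg s)(''c'' := ?c, ''lo'' := Suc ?c)\<rparr>)"
      using b by (simp add: bracket_def par_def inp_def)
    ultimately have "cost_inv f M i' (s\<lparr>nreg := (nreg s)(''c'' := ?c, ''lo'' := Suc ?c)\<rparr>)"
      using c up S high small' by (simp add: cost_inv_def)
    with False S i' show ?thesis by (simp add: bisect_costs_step_def)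
  next
    case True
    let ?mu = "1 / f ?c"
    let ?s1 = "s\<lparr>nreg := (nreg s)(''c'' := ?c), rreg := (rreg s)(''mu'' := ?mu)\<rparr>"
    let ?rest = "Cond (NLess (NConst 0) (NReg ''ok'')) (NSet ''up'' (NReg ''c''))
          (NSet ''lo'' (NAdd (NReg ''c'') (NConst 1)))"
    have b1: "bracket ?s1" using b by (simp add: bracket_def par_def inp_def)
    have "runs (probe ;; ?rest) ?s1 (probe_time + 2) (cost_inv f M i')"
    proof (rule runs_Seq[OF runs_mono[OF runs_probe_bracket[OF b1, of ?mu] order.refl] order.refl])
      fix s2
      assume 2: "bracket s2 \<and> unchanged probe ?s1 s2 \<and>
        (if 0 < nreg s2 ''ok'' then rreg s2 ''mus'' = ?mu \<and> rreg s2 ''lambda'' = rreg ?s1 ''lambda''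
         else rreg s2 ''lambda'' = 1 / ?mu \<and> rreg s2 ''mus'' = rreg ?s1 ''mus'' \<and>
           center_set s2 = center_set ?s1)"
      have s2: "nreg s2 ''c'' = ?c" "nreg s2 ''lo'' = ?lo" "nreg s2 ''up'' = ?up" "rarr s2 ''S'' = f"
        using 2 S by (auto simp: unchanged_def probe_vars)
      show "runs ?rest s2 2 (cost_inv f M i')"
      proof (cases "0 < nreg s2 ''ok''")
        case ok: True
        have "bracket (s2\<lparr>nreg := (nreg s2)(''up'' := ?c)\<rparr>)"
          using 2 by (simp add: bracket_def par_def inp_def)
        moreover have "\<forall>x. ?c \<le> x \<longrightarrow> x < M \<longrightarrow> 1 \<le> ?mu * f x" using above True by auto
        ultimately have "cost_inv f M i' (s2\<lparr>nreg := (nreg s2)(''up'' := ?c)\<rparr>)"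
          using 2 ok s2 c up low small' by (simp add: cost_inv_def)
        with ok s2 show ?thesis by simp
      next
        case fail: False
        have "bracket (s2\<lparr>nreg := (nreg s2)(''lo'' := Suc ?c)\<rparr>)"
          using 2 by (simp add: bracket_def par_def inp_def)
        moreover have "\<forall>x<Suc ?c. f x \<le> f ?c" using below by auto
        ultimately have "cost_inv f M i' (s2\<lparr>nreg := (nreg s2)(''lo'' := Suc ?c)\<rparr>)"
          using 2 fail s2 c up high small' by (simp add: cost_inv_def)
        with fail s2 show ?thesis by simp
      qed
    qed (use True in auto)
    with True S i' show ?thesis by (simp add: bisect_costs_step_def add.commute)
  qed
qed

lemma runs_bisect_costs:
  assumes b: "bracket s" and M: "nreg s ''M'' = 2 ^ p" and f: "mono_on {..<2 ^ p} (rarr s ''S'')"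
  shows "runs bisect_costs s ((p + 1) * (probe_time + 6) + 3) (\<lambda>s'. bracket s' \<and>
    (\<forall>x<2 ^ p. rarr s ''S'' x \<le> rreg s' ''lambda'' \<or> 1 \<le> rreg s' ''mus'' * rarr s ''S'' x))"
    (is "runs _ _ _ ?R")
proof -
  let ?f = "rarr s ''S''" and ?s1 = "s\<lparr>nreg := (nreg s)(''lo'' := 0, ''up'' := 2 ^ p)\<rparr>"
  have "runs (While (NLess (NReg ''lo'') (NReg ''up'')) bisect_costs_step) ?s1
    ((p + 1) * (probe_time + 6) + 1) ?R"
  \<comment> \<open>The initial length \<open>2 ^ p\<close> is strictly below
    \<open>2 ^ (p + 1)\<close>, whence \<open>p + 1\<close> rounds.\<close>
  proof (rule runs_While[where I = "cost_inv ?f (2 ^ p)" and i = "p + 1" and B = "probe_time + 5"], goal_cases)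
    case 1
    have "bracket ?s1" using b by (simp add: bracket_def par_def inp_def)
    then show ?case by (simp add: cost_inv_def)
  next
    case (2 i s')
    then show ?case using f by (intro runs_bisect_costs_step) auto
  next
    case (3 i s')
    then have "nreg s' ''lo'' = nreg s' ''up''" by (auto simp: cost_inv_def)
    with 3(1) show ?case by (auto simp: cost_inv_def) (metis not_less)
  qed simp
  with M show ?thesis by (simp add: bisect_costs_def)
qed

definition solved :: "store \<Rightarrow> bool" where
  "solved s \<longleftrightarrow> bracket s \<and> capped_cost G (ennreal (rreg s ''lambda'')) (center_set s) < 1"

\<comment> \<open>\<open>R\<close> is \<open>0\<close> if the probe of \<open>refine\<close> failed, and otherwise \<open>n ^ 5\<close> halved once per round.\<close>
definition gap_inv :: "nat \<Rightarrow> store \<Rightarrow> bool" where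
  "gap_inv i s \<longleftrightarrow> bracket s \<and> (rreg s ''R'' \<le> 1 \<and> solved s \<or>
     0 < rreg s ''lambda'' \<and> 0 < rreg s ''mus'' \<and> 0 \<le> rreg s ''R'' \<and> rreg s ''R'' \<le> 2 ^ i \<and>
     1 / rreg s ''mus'' - rreg s ''lambda'' \<le> rreg s ''lambda'' * rreg s ''R'' / (real n)\<^sup>2)"

text \<open>Replacing either end by the midpoint halves the difference, matching the halved
  \<open>R\<close>; a larger \<open>lambda\<close> only weakens the relative bound.\<close>

lemma runs_bisect_gap_step:
  assumes inv: "gap_inv i s" and guard: "1 < rreg s ''R''"
  shows "0 < i \<and> runs bisect_gap_step s (probe_time + 2) (gap_inv (i - 1))"
proof -
  let ?L = "rreg s ''lambda''" and ?H = "1 / rreg s ''mus''" and ?R = "rreg s ''R''"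
  have b: "bracket s" and L: "0 < ?L" and H: "0 < ?H" and R: "0 \<le> ?R" "?R \<le> 2 ^ i"
    and gap: "?H - ?L \<le> ?L * ?R / (real n)\<^sup>2"
    using inv guard by (auto simp: gap_inv_def)
  have "0 < i" using R guard by (cases i) auto
  then obtain i' where i': "i = Suc i'" by (cases i) auto
  define h where "h = (?L + ?H) / 2"
  have h: "0 < h" using add_pos_pos[OF L H] by (simp add: h_def)
  let ?mu = "2 / (?L + ?H)"
  have mu: "?mu = 1 / h" "0 < ?mu" using h by (auto simp: h_def)
  let ?s1 = "s\<lparr>rreg := (rreg s)(''mu'' := ?mu)\<rparr>"
  have b1: "bracket ?s1" using b by (simp add: bracket_def par_def inp_def)
  have "runs (probe ;; RSet ''R'' (RDiv (RReg ''R'') (nat_real 2))) ?s1 (probe_time + 1) (gap_inv i')"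
  proof (rule runs_Seq[OF runs_mono[OF runs_probe_bracket[OF b1, of ?mu] order.refl] order.refl])
    fix s2
    assume 2: "bracket s2 \<and> unchanged probe ?s1 s2 \<and>
      (if 0 < nreg s2 ''ok'' then rreg s2 ''mus'' = ?mu \<and> rreg s2 ''lambda'' = rreg ?s1 ''lambda''
       else rreg s2 ''lambda'' = 1 / ?mu \<and> rreg s2 ''mus'' = rreg ?s1 ''mus'' \<and>
         center_set s2 = center_set ?s1)"
    have s2: "rreg s2 ''R'' = ?R" using 2 by (auto simp: unchanged_def probe_vars)
    have "bracket (s2\<lparr>rreg := (rreg s2)(''R'' := ?R / 2)\<rparr>)"
      using 2 by (simp add: bracket_def par_def inp_def)
    moreover have "0 < rreg s2 ''lambda'' \<and> 0 < rreg s2 ''mus'' \<and>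
      1 / rreg s2 ''mus'' - rreg s2 ''lambda'' \<le> rreg s2 ''lambda'' * (?R / 2) / (real n)\<^sup>2"
    proof (cases "0 < nreg s2 ''ok''")
      case True
      have "h - ?L \<le> ?L * (?R / 2) / (real n)\<^sup>2" using gap by (simp add: h_def field_simps)
      with True 2 mu L show ?thesis by simp
    next
      case False
      have "?H - h \<le> h * (?R / 2) / (real n)\<^sup>2"
      \<comment> \<open>The ends need not be ordered: if the midpoint is below \<open>?L\<close>,
        then \<open>?H < ?L\<close> and the new gap is negative anyway.\<close>
      proof (cases "?L \<le> h")
        case True
        have "?H - h \<le> ?L * (?R / 2) / (real n)\<^sup>2" using gap by (simp add: h_def field_simps)
        also have "\<dots> \<le> h * (?R / 2) / (real n)\<^sup>2"
          using True R by (intro divide_right_mono mult_right_mono) auto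
        finally show ?thesis .
      next
        case False
        then have "?H - h \<le> 0" by (simp add: h_def)
        also have "0 \<le> h * (?R / 2) / (real n)\<^sup>2" using h R by simp
        finally show ?thesis .
      qed
      with False 2 mu h H show ?thesis by simp
    qed
    ultimately show "runs (RSet ''R'' (RDiv (RReg ''R'') (nat_real 2))) s2 1 (gap_inv i')"
      using s2 R i' by (simp add: gap_inv_def)
  qed (use mu in auto)
  with i' show ?thesis by (simp add: bisect_gap_step_def add.commute)
qed

lemma runs_refine:
  assumes b: "bracket s" and L: "0 < rreg s ''lambda''" and n2: "n \<le> 2 ^ p"
    and costs: "\<forall>e<m. cst e \<le> rreg s ''lambda'' \<or> 1 \<le> rreg s ''mus'' * cst e"
  shows "runs refine s (probe_time + 3 + (5 * p * (probe_time + 3) + 1)) solved"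
proof -
  let ?L = "rreg s ''lambda''" and ?loop = "While (RLess (nat_real 1) (RReg ''R'')) bisect_gap_step"
  let ?set = "Cond (NLess (NConst 0) (NReg ''ok''))
       (RSet ''R'' (RMul (RMul n_cubed (RNat (NReg ''n''))) (RNat (NReg ''n''))))
       (RSet ''R'' (nat_real 0))"
  let ?mu = "1 / (?L * real n ^ 3)"
  let ?s1 = "s\<lparr>rreg := (rreg s)(''mu'' := ?mu)\<rparr>"
  have n: "0 < real n" using n_ge_6 by simp
  have mu: "0 < ?mu" using L n by simp
  have n_reg: "nreg s ''n'' = n" using b by (simp add: bracket_def par_def inp_def)
  have b1: "bracket ?s1" using b by (simp add: bracket_def par_def inp_def)
  \<comment> \<open>The start value satisfies \<open>n^5 <= 2 ^ (5 * p)\<close> by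
    \<open>n <= 2 ^ p\<close>, so \<open>5 * p\<close> halvings suffice.\<close>
  have loop: "runs ?loop u (5 * p * (probe_time + 3) + 1) solved" if "gap_inv (5 * p) u" for u
  proof (rule runs_While[where I = gap_inv and B = "probe_time + 2", OF that], goal_cases)
    case (1 i s')
    then show ?case by (intro runs_bisect_gap_step) auto
  next
    case (2 i s')
    then have R: "rreg s' ''R'' \<le> 1" by simp
    show ?case
    proof (cases "solved s'")
      case False
      with 2 have s': "bracket s'" "0 < rreg s' ''lambda''" "0 < rreg s' ''mus''"
        "1 / rreg s' ''mus'' - rreg s' ''lambda'' \<le> rreg s' ''lambda'' * rreg s' ''R'' / (real n)\<^sup>2"
        by (auto simp: gap_inv_def)
      note s'(4)
      also have "rreg s' ''lambda'' * rreg s' ''R'' / (real n)\<^sup>2 \<le> rreg s' ''lambda'' / (real n)\<^sup>2"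
        using R s'(2) by (intro divide_right_mono mult_left_le) auto
      finally show ?thesis
        using s' by (auto simp: solved_def bracket_def intro!: capped_cost_close)
    qed
  qed (simp add: algebra_simps)
  have "runs (probe ;; ?set ;; ?loop) ?s1 (probe_time + (2 + (5 * p * (probe_time + 3) + 1))) solved"
  proof (rule runs_Seq[OF runs_mono[OF runs_probe_bracket[OF b1, of ?mu] order.refl] order.refl])
    fix s2
    assume 2: "bracket s2 \<and> unchanged probe ?s1 s2 \<and>
      (if 0 < nreg s2 ''ok'' then rreg s2 ''mus'' = ?mu \<and> rreg s2 ''lambda'' = rreg ?s1 ''lambda''
       else rreg s2 ''lambda'' = 1 / ?mu \<and> rreg s2 ''mus'' = rreg ?s1 ''mus'' \<and>
         center_set s2 = center_set ?s1)"
    have n2': "nreg s2 ''n'' = n" using 2 by (simp add: bracket_def par_def inp_def)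
    show "runs (?set ;; ?loop) s2 (2 + (5 * p * (probe_time + 3) + 1)) solved"
    proof (cases "0 < nreg s2 ''ok''")
      case True
      let ?s3 = "s2\<lparr>rreg := (rreg s2)(''R'' := real n * real n * real n * real n * real n)\<rparr>"
      have "bracket ?s3" using 2 by (simp add: bracket_def par_def inp_def)
      moreover have "real n * real n * real n * real n * real n = real n ^ 5"
        by (simp add: numeral_eq_Suc)
      moreover have "real n ^ 5 \<le> 2 ^ (5 * p)"
      proof -
        have "real n \<le> 2 ^ p" using n2 by (metis of_nat_le_iff of_nat_numeral of_nat_power)
        then have "real n ^ 5 \<le> (2 ^ p) ^ 5" by (intro power_mono) auto
        then show ?thesis by (simp flip: power_mult add: mult.commute)
      qed
      moreover have "1 / ?mu - ?L \<le> ?L * real n ^ 5 / (real n)\<^sup>2"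
      proof -
        have "?L * real n ^ 5 / (real n)\<^sup>2 = 1 / ?mu"
          using n by (simp add: field_simps numeral_eq_Suc)
        with L show ?thesis by simp
      qed
      ultimately have "gap_inv (5 * p) ?s3" using 2 True L mu by (simp add: gap_inv_def)
      from loop[OF this] True n2' show ?thesis by simp
    next
      case False
      let ?s3 = "s2\<lparr>rreg := (rreg s2)(''R'' := 0)\<rparr>"
      have b3: "bracket ?s3" using 2 by (simp add: bracket_def par_def inp_def)
      have s2: "rreg s2 ''lambda'' = ?L * real n ^ 3" "rreg s2 ''mus'' = rreg s ''mus''"
        using 2 False by auto
      \<comment> \<open>The failure raised \<open>lambda\<close> to \<open>?L * n^3\<close>, so
        costs at most \<open>?L\<close> are now at most \<open>lambda / n^3\<close>.\<close>
      have "capped_cost G (ennreal (?L * real n ^ 3)) (center_set ?s3) < 1"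
      proof (rule capped_cost_gap)
        show "good (rreg s ''mus'') (center_set ?s3)" using b3 s2 by (simp add: bracket_def)
        show "cst e \<le> ?L * real n ^ 3 / real n ^ 3 \<or> 1 \<le> rreg s ''mus'' * cst e" if "e < m" for e
          using costs that n by simp
      qed (use L in simp)
      with b3 s2 have "gap_inv (5 * p) ?s3" by (simp add: gap_inv_def solved_def)
      from loop[OF this] False show ?thesis by simp
    qed
  qed (use mu in auto)
  then have "runs (probe ;; ?set ;; ?loop) ?s1 (probe_time + 3 + (5 * p * (probe_time + 3) + 1) - 1) solved"
    by (rule runs_mono) auto
  then show ?thesis using n_reg
    unfolding refine_def runs_Seq_RSet by (simp add: power3_eq_cube mult.assoc)
qed

lemma runs_search:
  assumes b: "bracket s"
  shows "runs search s (60 * m * (clog m + 1) + ((clog m + 1) * (probe_time + 6) + 3 +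
    (probe_time + 4 + (5 * clog m * (probe_time + 3) + 1)))) solved"
proof -
  let ?p = "clog m" and ?tail = "Cond (RLess (nat_real 0) (RReg ''lambda'')) refine Skip"
  have m: "1 \<le> m" using n_ge_6 n_le_m by simp
  have m_reg: "nreg s ''m'' = m" using b by (simp add: bracket_def par_def inp_def)
  have cost: "rarr s ''cost'' ` {..<m} = cst ` {..<m}"
    using b by (intro image_cong) (auto simp: bracket_def par_def inp_def)
  show ?thesis
    unfolding search_def
  proof (rule runs_Seq[OF runs_mono[OF runs_unchanged[OF runs_sort_costs[OF m_reg m]] order.refl] order.refl])
    fix s1
    assume 1: "(nreg s1 ''M'' = 2 ^ ?p \<and> mono_on {..<2 ^ ?p} (rarr s1 ''S'') \<and>
      rarr s ''cost'' ` {..<m} \<subseteq> rarr s1 ''S'' ` {..<2 ^ ?p}) \<and> unchanged sort_costs s s1"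
    have "par s1" by (rule par_unchanged[of s sort_costs]) (use b 1 in \<open>auto simp: bracket_def sort_costs_vars\<close>)
    with b 1 have b1: "bracket s1" by (simp add: bracket_def unchanged_def sort_costs_vars)
    show "runs (bisect_costs ;; ?tail) s1 ((?p + 1) * (probe_time + 6) + 3 +
        (probe_time + 4 + (5 * ?p * (probe_time + 3) + 1))) solved"
    proof (rule runs_Seq[OF runs_mono[OF runs_bisect_costs[OF b1, of ?p] order.refl] order.refl])
      fix s2
      assume 2: "bracket s2 \<and> (\<forall>x<2 ^ ?p. rarr s1 ''S'' x \<le> rreg s2 ''lambda'' \<or>
        1 \<le> rreg s2 ''mus'' * rarr s1 ''S'' x)"
      have costs: "\<forall>e<m. cst e \<le> rreg s2 ''lambda'' \<or> 1 \<le> rreg s2 ''mus'' * cst e"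
      proof (intro allI impI)
        fix e assume "e < m"
        then have "cst e \<in> rarr s1 ''S'' ` {..<2 ^ ?p}" using 1 cost by blast
        with 2 show "cst e \<le> rreg s2 ''lambda'' \<or> 1 \<le> rreg s2 ''mus'' * cst e" by auto
      qed
      show "runs ?tail s2 (probe_time + 4 + (5 * ?p * (probe_time + 3) + 1)) solved"
      proof (cases "0 < rreg s2 ''lambda''")
        case True
        have "n \<le> 2 ^ ?p" using n_le_m clog_ge[of m] by linarith
        from runs_refine[OF conjunct1[OF 2] True this costs] True show ?thesis
          by (auto elim: runs_mono)
      next
        case False
        with 2 have L: "rreg s2 ''lambda'' = 0" by (auto simp: bracket_def)
        \<comment> \<open>At \<open>lambda = 0\<close> every cost is 0 or too large for a witness
          edge, so the gap argument applies without refinement.\<close>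
        have "capped_cost G (ennreal (rreg s2 ''lambda'')) (center_set s2) < 1"
          using 2 L costs by (intro capped_cost_gap[of "rreg s2 ''mus''"]) (auto simp: bracket_def)
        with 2 False show ?thesis by (simp add: solved_def)
      qed
    qed (use 1 in auto)
  qed
qed

lemma runs_solve:
  "runs solve (input_store G es) (600 * (clog m + 1) * m * (T + 1)) (\<lambda>s. solved s \<or>
     nreg s ''infinite'' = 1 \<and> nreg s ''size'' = 0 \<and> lp_opt G = \<infinity>)"
    (is "runs _ _ _ ?R")
proof -
  let ?tail = "Cond (NLess (NConst 0) (NReg ''ok'')) search
       (NSet ''infinite'' (NConst 1) ;; NSet ''size'' (NConst 0))"
  let ?s = "input_store G es"
  let ?s1 = "?s\<lparr>rreg := (rreg ?s)(''al'' := al, ''cap'' := cap, ''th'' := th, ''mu'' := 0)\<rparr>"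
  let ?N = "60 * m * (clog m + 1) + ((clog m + 1) * (probe_time + 6) + 3 +
    (probe_time + 4 + (5 * clog m * (probe_time + 3) + 1)))"
  have inp: "inp ?s" by (simp add: inp_def input_store_def n_def)
  then have par: "par ?s1" by (simp add: par_def inp_def)
  have params: "runs set_params ?s 4 (\<lambda>s. s = ?s1)"
    using inp by (simp add: set_params_def inp_def al_def cap_def th_def power2_eq_square)
  have "runs solve ?s (4 + (probe_time + (?N + 3))) ?R"
    unfolding solve_def
  proof (rule runs_Seq[OF runs_mono[OF params order.refl] order.refl])
    fix s assume s: "s = ?s1"
    show "runs (probe ;; ?tail) s (probe_time + (?N + 3)) ?R"
      unfolding s
    proof (rule runs_Seq[OF runs_mono[OF runs_unchanged[OF runs_probe[OF par, of 0]] order.refl] order.refl])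
      fix s2 assume 2: "probe_post 0 ?s1 s2 \<and> unchanged probe ?s1 s2"
      have par2: "par s2" by (rule par_unchanged[of ?s1 probe]) (use par 2 in \<open>auto simp: probe_vars\<close>)
      show "runs ?tail s2 (?N + 3) ?R"
      proof (cases "0 < nreg s2 ''ok''")
        case True
        have "nreg s2 ''infinite'' = 0"
          using 2 by (simp add: unchanged_def probe_vars input_store_def)
        \<comment> \<open>Memory starts at 0, so \<open>lambda = 0\<close> is a trivial lower end,
          and \<open>mus = 0\<close> is the infinite upper end that just succeeded.\<close>
        with 2 True par2 have "bracket s2"
          by (simp add: bracket_def probe_post_def input_store_def)
        from runs_search[OF this] have "runs search s2 (?N + 2) ?R"
          by (rule runs_mono) auto
        with True show ?thesis by simp
      next
        case False
        with 2 have "lp_opt G = \<infinity>" by (simp add: probe_post_def cert_def)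
        with False show ?thesis by simp
      qed
    qed auto
  qed
  moreover have "4 + (probe_time + (?N + 3)) \<le> 600 * (clog m + 1) * m * (T + 1)"
  proof -
    define X where "X = m * (T + 1)"
    have m: "6 \<le> m" using n_ge_6 n_le_m by simp
    have X: "m \<le> X" "6 \<le> X" using m by (auto simp: X_def)
    have t: "probe_time = 50 * X" by (simp add: X_def)
    have "60 * m * (clog m + 1) \<le> 60 * X * (clog m + 1)" using X by (intro mult_le_mono) auto
    moreover have "(clog m + 1) * (probe_time + 6) \<le> (clog m + 1) * (51 * X)"
      unfolding t using X by (intro mult_le_mono) auto
    moreover have "5 * clog m * (probe_time + 3) \<le> 5 * (clog m + 1) * (51 * X)"
      unfolding t using X by (intro mult_le_mono) auto
    moreover have "2 * probe_time + 20 \<le> 110 * X * (clog m + 1)"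
      unfolding t using X by (simp add: algebra_simps)
    moreover have "60 * X * (clog m + 1) + (clog m + 1) * (51 * X) + 5 * (clog m + 1) * (51 * X) +
        110 * X * (clog m + 1) \<le> 600 * (clog m + 1) * m * (T + 1)"
      by (simp add: X_def algebra_simps)
    ultimately show ?thesis by linarith
  qed
  ultimately show ?thesis by (rule runs_mono) auto
qed

section \<open>The final bound\<close>

lemma clog_le_ln: "real (clog m + 1) \<le> 4 * ln (real m)"
proof -
  have m: "6 \<le> m" using n_ge_6 n_le_m by simp
  have "1 \<le> ln (3::real)" using exp_le by (simp add: ln_ge_iff)
  also have "\<dots> \<le> ln (real m)" using m by (subst ln_le_cancel_iff) auto
  finally have ln_m: "1 \<le> ln (real m)" .
  have ln2: "2 / 3 \<le> ln (2::real)" "ln (2::real) \<le> 1"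
    using ln_2_less_1 ln2_ge_two_thirds by auto
  have "real (2 ^ clog m) \<le> real (2 * m)" using clog_less[of m] m by (intro of_nat_mono) auto
  then have "ln (2 ^ clog m) \<le> ln (2 * real m)" using m by (subst ln_le_cancel_iff) auto
  then have "real (clog m) * ln 2 \<le> ln 2 + ln (real m)"
    using m by (auto simp: ln_realpow ln_mult split: if_splits)
  moreover have "real (clog m) * (2 / 3) \<le> real (clog m) * ln 2" using ln2 by (intro mult_left_mono) auto
  \<comment> \<open>\<open>clog m * 2/3 <= 1 + ln m\<close> yields
    \<open>clog m + 1 <= 5/2 + 3/2 * ln m\<close>, and \<open>ln m >= 1\<close> turns this into the
    factor 4.\<close>
  ultimately show ?thesis using ln2 ln_m by simp
qed

lemma solve_correct:
  "\<exists>t s lam C. exec solve (input_store G es) t s \<and>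
     real t \<le> 7200 * (real k * real m * ln (real n / real k) * ln (real m)) \<and>
     outputs s lam C \<and> lam \<le> lp_opt G \<and> C \<subseteq> centers G \<and> int (card C) \<le> center_bound G \<and>
     capped_cost G lam C < 1"
proof -
  obtain t s where t: "exec solve (input_store G es) t s" "t \<le> 600 * (clog m + 1) * m * (T + 1)"
    and s: "solved s \<or> nreg s ''infinite'' = 1 \<and> nreg s ''size'' = 0 \<and> lp_opt G = \<infinity>"
    using runs_solve by (auto simp: runs_def)
  have "real t \<le> real (600 * (clog m + 1) * m * (T + 1))" using t(2) by (rule of_nat_mono)
  also have "\<dots> = 600 * real m * (real (clog m + 1) * (real T + 1))" by (simp add: algebra_simps)
  \<comment> \<open>The constants multiply to \<open>600 * 4 * 3 = 7200\<close>.\<close>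
  also have "\<dots> \<le> 600 * real m * ((4 * ln (real m)) * (3 * (real k * ln (real n / real k))))"
    using clog_le_ln T_le k_ln_ge_2 by (intro mult_left_mono mult_mono) auto
  finally have time: "real t \<le> 7200 * (real k * real m * ln (real n / real k) * ln (real m))"
    by (simp add: algebra_simps)
  from s show ?thesis
  proof
    assume "solved s"
    then have "outputs s (ennreal (rreg s ''lambda'')) (center_set s)"
      "ennreal (rreg s ''lambda'') \<le> lp_opt G" "center_set s \<subseteq> centers G" "card (center_set s) \<le> T"
      "capped_cost G (ennreal (rreg s ''lambda'')) (center_set s) < 1"
      by (auto simp: outputs_def solved_def bracket_def good_def)
    with t(1) time T_eq show ?thesis by (metis of_nat_le_iff)
  next
    assume inf: "nreg s ''infinite'' = 1 \<and> nreg s ''size'' = 0 \<and> lp_opt G = \<infinity>"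
    \<comment> \<open>The minimum over the empty set is infinite, and infinity divided by infinity
      is 0.\<close>
    have "capped_cost G \<infinity> {} = 0"
      by (simp add: capped_cost_def capped_cost_of_def Let_def)
    moreover have "outputs s \<infinity> {}" using inf by (simp add: outputs_def)
    ultimately show ?thesis using t(1) time inf T_eq
      by (intro exI[of _ t] exI[of _ s] exI[of _ \<infinity>] exI[of _ "{}"]) auto
  qed
qed

end

theorem theorem3:
  "\<exists>(P :: com) (K :: real). \<forall>(G :: (nat, nat) kmedian) (es :: (nat \<times> nat) list) (k :: nat) (n :: nat) (m :: nat).
     kmedian_instance G \<and> k = medians G \<and> n = num_customers G \<and> m = num_edges G \<and>
     2 \<le> k \<and> real k \<le> real n / 3 \<and>
     (\<forall>j \<in> customers G. \<exists>i \<in> centers G. ext_cost G i j = 0) \<and>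
     edge_list G es \<longrightarrow>
     (\<exists>(t :: nat) (s :: store) (lam :: ennreal) (C :: nat set).
        exec P (input_store G es) t s \<and>
        real t \<le> K * (real k * real m * ln (real n / real k) * ln (real m)) \<and>
        outputs s lam C \<and>
        lam \<le> lp_opt G \<and> C \<subseteq> centers G \<and> int (card C) \<le> center_bound G \<and>
        capped_cost G lam C < 1)"
proof (rule exI[of _ solve], rule exI[of _ 7200], intro allI impI)
  fix G :: "(nat, nat) kmedian" and es k n m
  assume *: "kmedian_instance G \<and> k = medians G \<and> n = num_customers G \<and> m = num_edges G \<and>
     2 \<le> k \<and> real k \<le> real n / 3 \<and>
     (\<forall>j \<in> customers G. \<exists>i \<in> centers G. ext_cost G i j = 0) \<and> edge_list G es"
  then interpret greedy_instance G es
    by unfold_locales (auto simp: num_customers_def)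
  have "n = greedy_instance.n G" "m = length es"
    using * m_eq by (auto simp: n_def num_customers_def)
  with * solve_correct show "\<exists>t s lam C. exec solve (input_store G es) t s \<and>
        real t \<le> 7200 * (real k * real m * ln (real n / real k) * ln (real m)) \<and>
        outputs s lam C \<and> lam \<le> lp_opt G \<and> C \<subseteq> centers G \<and> int (card C) \<le> center_bound G \<and>
        capped_cost G lam C < 1" by simp
qed

end
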